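(* Let $\mathcal{O}=\left((\Omega,P),\{p_\mu(\cdot):\mu\in\mathcal{M}\},\mathcal{F}\right)$ be a good observation scheme, $\mathcal{X}\subset\mathbf{R}^n$ a convex compact set, $X_1,\dots,X_I\subset\mathcal{X}$ convex compact sets, $X=\bigcup_{i=1}^IX_i$, $x\mapsto A(x):\mathcal{X}\to\mathcal{M}$ an affine mapping, and $f:\mathcal{X}\to\mathbf{R}$ a continuous $N$-convex function. Let $a_0<b_0$ be reals with $a_0\le\min_{u\in X}f(u)$ and $b_0\ge\max_{u\in X}f(u)$, and let $\epsilon\in(0,1/2)$. Consider the Bisection procedure described in the context, run on a stationary $K$-repeated observation $\omega^K=(\omega_1,\dots,\omega_K)$ with $\omega_t$ i.i.d. drawn from $p_{A(x)}$, $x\in X$; let $\bar\Delta$ be its output segment. Then: (i) [reliability] For every positive integer $L$ and every $\varkappa>0$, Bisection with control parameters $L$, $\delta=\frac{\epsilon}{2L}$, and $\varkappa$ is $(1-\epsilon)$-reliable: for every $x\in X$, the $p_{A(x)}$-probability of the event $f(x)\in\bar\Delta$ is at least $1-\epsilon$. (ii) [near-optimality] Let $\bar\rho>0$ and a positive integer $\bar K$ be such that there exists a $(\bar\rho,\epsilon)$-reliable estimate $\widehat f(\cdot)$ of $f(x)$, $x\in X$, via stationary $\bar K$-repeated observation $\omega^{\bar K}$ with $\omega_k\sim p_{A(x)}$, $1\le k\le\bar K$. Given $\rho>2\bar\rho$, the Bisection estimate (the midpoint of $\bar\Delta$) utilizing stationary $K$-repeated observations with $$K=\left\lceil\frac{2\ln(2LNI/\epsilon)}{\ln([4\epsilon(1-\epsilon)]^{-1})}\bar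 K\right\rceil,$$ the control parameters being $$L=\left\lceil\log_2\left(\frac{b_0-a_0}{2\rho}\right)\right\rceil,\qquad\delta=\frac{\epsilon}{2L},\qquad\varkappa=\rho-2\bar\rho,$$ is $(\rho,\epsilon)$-reliable. (When $b_0-a_0\le2\rho$, so that the formula for $L$ gives a non-positive value, the estimate is understood to be the observation-independent value $\frac{a_0+b_0}{2}$.)
   Context: **Good observation scheme.** A good observation scheme (o.s.) is a collection $\mathcal{O}=\left((\Omega,P),\{p_\mu(\cdot):\mu\in\mathcal{M}\},\mathcal{F}\right)$ where: (1) $\Omega$ is a Polish (complete metric separable) space and $P$ is a $\sigma$-finite $\sigma$-additive Borel reference measure on $\Omega$ such that $\Omega$ is the support of $P$; (2) $\mathcal{M}$ is a convex relatively open set in some $\mathbf{R}^M$, and for $\mu\in\mathcal{M}$, $p_\mu(\cdot)$ is a probability density on $\Omega$ w.r.t. $P$; the function $p_\mu(\omega)$ is positive and continuous in $(\mu,\omega)\in\mathcal{M}\times\Omega$; (3) $\mathcal{F}$ is a finite-dimensional linear subspace of the space of continuous functions on $\Omega$, containing the constants and all functions $\ln(p_\mu(\cdot)/p_\nu(\cdot))$, $\mu,\nu\in\mathcal{M}$, and such that $\Phi_{\mathcal{O}}(\phi;\mu)=\ln\left(\int_\Omega e^{\phi(\omega)}p_\mu(\omega)P(d\omega)\right)$ is real-valued on $\mathcal{F}\times\mathcal{M}$ and concave in $\mu\in\mathcal{M}$. **$N$-convexity.** $f$ is $N$-convex if for every $a\in\mathbf{R}$ the sets $\mathcal{X}^{a,\ge}=\{x\in\mathcal{X}:f(x)\ge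 a\}$ and $\mathcal{X}^{a,\le}=\{x\in\mathcal{X}:f(x)\le a\}$ can be represented as unions of at most $N$ closed convex sets: $\mathcal{X}^{a,\ge}=\bigcup_{\nu=1}^N\mathcal{X}^{a,\ge}_\nu$, $\mathcal{X}^{a,\le}=\bigcup_{\nu=1}^N\mathcal{X}^{a,\le}_\nu$ (some of the sets may be empty). Such representations are fixed for all $a$. **Reliability of an estimate.** A (Borel) estimate $\widehat f:\Omega^K\to\mathbf{R}$ is $(\rho,\epsilon)$-reliable if for every $x\in X$ one has $|\widehat f(\omega^K)-f(x)|\le\rho$ with probability at least $1-\epsilon$ when $\omega_1,\dots,\omega_K$ are i.i.d. drawn from $p_{A(x)}$. "$p_{A(x)}$-probability" always refers to this distribution of $\omega^K$. **Upper and lower $a$-sets.** For real $a$, let $Z^{a,\ge}_i$, $1\le i\le I_{a,\ge}$, be the nonempty sets among $X_i\cap\mathcal{X}^{a,\ge}_\nu$, $1\le i\le I$, $1\le\nu\le N$, arranged in a sequence; $a$ is upper-feasible if $I_{a,\ge}>0$, and upper-infeasible otherwise. Similarly, $Z^{a,\le}_i$, $1\le i\le I_{a,\le}$, are the nonempty sets among $X_i\cap\mathcal{X}^{a,\le}_\nu$; $a$ is lower-feasible if $I_{a,\le}>0$, and lower-infeasible otherwise. **Right tests.** For a segment $\Delta=[a,b]$, $a<b$, with $a$ lower-feasible, the right test $\mathcal{T}^K_{\Delta,r}:\Omega^K\to\{\mathtt{right},\mathtt{left}\}$ and its risk $\sigma_{\Delta,r}\ge0$ are: - If $b$ is upper-infeasible: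 $\mathcal{T}^K_{\Delta,r}\equiv\mathtt{left}$, $\sigma_{\Delta,r}=0$. - If $b$ is upper-feasible: for $1\le i\le I_{b,\ge}$, $1\le j\le I_{a,\le}$ let $$(r_{ij\Delta},s_{ij\Delta})\in\mathop{\mathrm{Argmax}}_{r\in Z^{b,\ge}_i,\,s\in Z^{a,\le}_j}\ln\left(\int_\Omega\sqrt{p_{A(r)}(\omega)p_{A(s)}(\omega)}\,P(d\omega)\right),$$ $$\phi_{ij\Delta}(\omega)=\tfrac12\ln\left(p_{A(r_{ij\Delta})}(\omega)/p_{A(s_{ij\Delta})}(\omega)\right),\qquad\phi^K_{ij\Delta}(\omega^K)=\sum_{t=1}^K\phi_{ij\Delta}(\omega_t),$$ $$\epsilon_{ij\Delta}=\int_\Omega\sqrt{p_{A(r_{ij\Delta})}(\omega)p_{A(s_{ij\Delta})}(\omega)}\,P(d\omega),\qquad E_{\Delta,r}=[\epsilon_{ij\Delta}^K]_{1\le i\le I_{b,\ge},\,1\le j\le I_{a,\le}}.$$ $\sigma_{\Delta,r}$ is the spectral norm of $E_{\Delta,r}$. Let $[g;h]$ be the Perron–Frobenius eigenvector of $\begin{bmatrix} 0 & E_{\Delta,r} \\ {E_{\Delta,r}^T} & 0 \end{bmatrix}$, so that $g>0$, $h>0$, $\sigma_{\Delta,r}g=E_{\Delta,r}h$, $\sigma_{\Delta,r}h=E_{\Delta,r}^Tg$, and let $D_{\Delta,r}(\omega^K)=[\phi^K_{ij\Delta}(\omega^K)-\ln(h_j)+\ln(g_i)]_{i,j}$. Then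 $\mathcal{T}^K_{\Delta,r}(\omega^K)=\mathtt{right}$ if the matrix $D_{\Delta,r}(\omega^K)$ has a (entrywise) nonnegative row, and $=\mathtt{left}$ otherwise. Given $\delta>0$, $\varkappa>0$: the segment $\Delta=[a,b]$ is $\delta$-good (right) if $a$ is lower-feasible, $b>a$ and $\sigma_{\Delta,r}\le\delta$; a $\delta$-good (right) segment $[a,b]$ is $\varkappa$-maximal if $[a,b-\varkappa]$ is not $\delta$-good (right). **Left tests.** For a segment $\Delta=[a,b]$, $a<b$, with $b$ upper-feasible: if $a$ is lower-infeasible, $\mathcal{T}^K_{\Delta,l}\equiv\mathtt{right}$ and $\sigma_{\Delta,l}=0$; if $a$ is lower-feasible, $\mathcal{T}^K_{\Delta,l}\equiv\mathcal{T}^K_{\Delta,r}$ and $\sigma_{\Delta,l}=\sigma_{\Delta,r}$. The segment $[a,b]$ is $\delta$-good (left) if $b$ is upper-feasible, $b>a$ and $\sigma_{\Delta,l}\le\delta$; a $\delta$-good (left) segment $[a,b]$ is $\varkappa$-maximal if $[a+\varkappa,b]$ is not $\delta$-good (left). **Bisection.** Control parameters: a positive integer $L$, $\delta\in(0,1)$, $\varkappa>0$. Given $\omega^K$: 1. Set $\Delta_0=[a_0,b_0]$. 2. Step $\ell$, $1\le\ell\le L$: given $\Delta_{\ell-1}=[a_{\ell-1},b_{\ell-1}]$ with $a_{\ell-1}<b_{\ell-1}$, (a) set $c_\ell=\frac12[a_{\ell-1}+b_{\ell-1}]$. If $c_\ell$ is not upper-feasible, set $\Delta_\ell=[a_{\ell-1},c_\ell]$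 and go to (e); if $c_\ell$ is not lower-feasible, set $\Delta_\ell=[c_\ell,b_{\ell-1}]$ and go to (e). (b) If $c_\ell$ is both upper- and lower-feasible, check whether $[c_\ell,b_{\ell-1}]$ is $\delta$-good (right). If not, terminate with output $\bar\Delta=\Delta_{\ell-1}$. Otherwise find $v_\ell$, $c_\ell<v_\ell\le b_{\ell-1}$, such that $\Delta_{\ell,\mathrm{rg}}=[c_\ell,v_\ell]$ is $\delta$-good (right) and $\varkappa$-maximal, as follows: check candidates $v^k_\ell=b_{\ell-1}-k\varkappa$, $k=0,1,\dots$, until for the first time $[c_\ell,v^k_\ell]$ is not $\delta$-good (right), and set $v_\ell=v^{k-1}_\ell$. (c) Similarly, check whether $[a_{\ell-1},c_\ell]$ is $\delta$-good (left). If not, terminate with output $\bar\Delta=\Delta_{\ell-1}$. Otherwise find $u_\ell$, $a_{\ell-1}\le u_\ell<c_\ell$, such that $\Delta_{\ell,\mathrm{lf}}=[u_\ell,c_\ell]$ is $\delta$-good (left) and $\varkappa$-maximal, by checking candidates $u^k_\ell=a_{\ell-1}+k\varkappa$, $k=0,1,\dots$, until for the first time $[u^k_\ell,c_\ell]$ is not $\delta$-good (left), and setting $u_\ell=u^{k-1}_\ell$. (d) Compute $\mathcal{T}^K_{\Delta_{\ell,\mathrm{rg}},r}(\omega^K)$ and $\mathcal{T}^K_{\Delta_{\ell,\mathrm{lf}},l}(\omega^K)$. If they are equal, set $\Delta_\ell=[c_\ell,b_{\ell-1}]$ when the common value is $\mathtt{right}$ and $\Delta_\ell=[a_{\ell-1},c_\ell]$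 when it is $\mathtt{left}$, and go to (e). Otherwise terminate with output $\bar\Delta=[u_\ell,v_\ell]$. (e) If $\ell<L$, pass to step $\ell+1$; otherwise terminate with output $\bar\Delta=\Delta_L$. 3. The output is the segment $\bar\Delta$; the Bisection estimate of $f(x)$ is the midpoint of $\bar\Delta$. *)

theory Defs
  imports "HOL-Analysis.Analysis" "HOL-Library.Function_Algebras"
begin

global_interpretation fun_space: vector_space "\<lambda>(c::real) (\<phi>::'w \<Rightarrow> real) \<omega>. c * \<phi> \<omega>"
  by unfold_locales (auto simp: fun_eq_iff algebra_simps)

text \<open>The observation space is the whole type \<open>'w\<close> of class \<^class>\<open>polish_space\<close>.\<close>

record ('w, 'm) obs_scheme =
  ref_measure :: "'w measure"
  params :: "'m set"
  dens :: "'m \<Rightarrow> 'w \<Rightarrow> real"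
  fspace :: "('w \<Rightarrow> real) set"

definition Phi :: "('w, 'm) obs_scheme \<Rightarrow> ('w \<Rightarrow> real) \<Rightarrow> 'm \<Rightarrow> real" where
  "Phi Ob \<phi> \<mu> = ln (\<integral>\<omega>. exp (\<phi> \<omega>) * dens Ob \<mu> \<omega> \<partial>ref_measure Ob)"

text \<open>The integrand of \<^const>\<open>Phi\<close> is positive, so \<^const>\<open>Phi\<close> is real-valued
  exactly when the integrand is integrable.\<close>

definition good_obs_scheme ::
  "('w::polish_space, 'm::euclidean_space) obs_scheme \<Rightarrow> bool" where
  "good_obs_scheme Ob \<longleftrightarrow>
     sets (ref_measure Ob) = sets borel \<and>
     sigma_finite_measure (ref_measure Ob) \<and>
     (\<forall>U. open U \<and> U \<noteq> {} \<longrightarrow> emeasure (ref_measure Ob) U > 0) \<and>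
     convex (params Ob) \<and> rel_open (params Ob) \<and>
     (\<forall>\<mu>\<in>params Ob. integrable (ref_measure Ob) (dens Ob \<mu>) \<and>
        (\<integral>\<omega>. dens Ob \<mu> \<omega> \<partial>ref_measure Ob) = 1) \<and>
     (\<forall>\<mu>\<in>params Ob. \<forall>\<omega>. dens Ob \<mu> \<omega> > 0) \<and>
     continuous_on (params Ob \<times> UNIV) (\<lambda>(\<mu>, \<omega>). dens Ob \<mu> \<omega>) \<and>
     fun_space.subspace (fspace Ob) \<and>
     (\<exists>B. finite B \<and> fspace Ob \<subseteq> fun_space.span B) \<and>
     (\<forall>\<phi>\<in>fspace Ob. continuous_on UNIV \<phi>) \<and>
     (\<forall>c. (\<lambda>\<omega>. c) \<in> fspace Ob) \<and>
     (\<forall>\<mu>\<in>params Ob. \<forall>\<nu>\<in>params Ob. (\<lambda>\<omega>. ln (dens Ob \<mu> \<omega> / dens Ob \<nu> \<omega>)) \<in> fspace Ob) \<and>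
     (\<forall>\<phi>\<in>fspace Ob. \<forall>\<mu>\<in>params Ob.
        integrable (ref_measure Ob) (\<lambda>\<omega>. exp (\<phi> \<omega>) * dens Ob \<mu> \<omega>)) \<and>
     (\<forall>\<phi>\<in>fspace Ob. concave_on (params Ob) (Phi Ob \<phi>))"

text \<open>The law of \<open>(\<omega>\<^sub>1, \<dots>, \<omega>\<^sub>K)\<close> i.i.d. with density \<open>dens Ob \<mu>\<close>; points of the
  \<open>K\<close>-fold product are functions on \<open>{1..K}\<close>.\<close>

definition sample_law :: "('w, 'm) obs_scheme \<Rightarrow> nat \<Rightarrow> 'm \<Rightarrow> (nat \<Rightarrow> 'w) measure" where
  "sample_law Ob K \<mu> =
     PiM {1..K} (\<lambda>_. density (ref_measure Ob) (\<lambda>\<omega>. ennreal (dens Ob \<mu> \<omega>)))"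

definition affinity :: "('w, 'm) obs_scheme \<Rightarrow> 'm \<Rightarrow> 'm \<Rightarrow> real" where
  "affinity Ob \<mu> \<nu> = (\<integral>\<omega>. sqrt (dens Ob \<mu> \<omega> * dens Ob \<nu> \<omega>) \<partial>ref_measure Ob)"

definition affine_map_on :: "'n::real_vector set \<Rightarrow> ('n \<Rightarrow> 'm::real_vector) \<Rightarrow> bool" where
  "affine_map_on S A \<longleftrightarrow> (\<exists>T c. linear T \<and> (\<forall>x\<in>S. A x = T x + c))"

text \<open>A function on \<open>S\<close> is \<open>N\<close>-convex if it has some representation \<open>(Xge, Xle)\<close> in the
  following sense; the procedures below depend on the representation, so it is kept as data.\<close>

definition N_convex_rep ::
  "'n::euclidean_space set \<Rightarrow> ('n \<Rightarrow> real) \<Rightarrow> nat \<Rightarrow>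
   (real \<Rightarrow> nat \<Rightarrow> 'n set) \<Rightarrow> (real \<Rightarrow> nat \<Rightarrow> 'n set) \<Rightarrow> bool" where
  "N_convex_rep S f N Xge Xle \<longleftrightarrow>
     (\<forall>a. {x\<in>S. f x \<ge> a} = (\<Union>\<nu>\<in>{1..N}. Xge a \<nu>) \<and>
          {x\<in>S. f x \<le> a} = (\<Union>\<nu>\<in>{1..N}. Xle a \<nu>) \<and>
          (\<forall>\<nu>\<in>{1..N}. closed (Xge a \<nu>) \<and> convex (Xge a \<nu>) \<and>
                       closed (Xle a \<nu>) \<and> convex (Xle a \<nu>)))"

text \<open>The data on which the tests depend: the scheme, the map \<open>A\<close>, the sets
  \<open>X 1, \<dots>, X I\<close>, the representation of the level sets of \<open>f\<close>, and a choice
  \<open>sel a b i j = (r, s)\<close> of maximizers for every segment \<open>[a, b]\<close>.\<close>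

record ('w, 'm, 'n) problem =
  scheme :: "('w, 'm) obs_scheme"
  encode :: "'n \<Rightarrow> 'm"
  num :: nat
  part :: "nat \<Rightarrow> 'n set"
  ncvx :: nat
  ge_rep :: "real \<Rightarrow> nat \<Rightarrow> 'n set"
  le_rep :: "real \<Rightarrow> nat \<Rightarrow> 'n set"
  sel :: "real \<Rightarrow> real \<Rightarrow> nat \<Rightarrow> nat \<Rightarrow> 'n \<times> 'n"

definition signal_set :: "('w, 'm, 'n) problem \<Rightarrow> 'n set" where
  "signal_set pr = (\<Union>i\<in>{1..num pr}. part pr i)"

definition reliable ::
  "('w::polish_space, 'm, 'n) problem \<Rightarrow> ('n \<Rightarrow> real) \<Rightarrow> nat \<Rightarrow> real \<Rightarrow> real \<Rightarrow>
   ((nat \<Rightarrow> 'w) \<Rightarrow> real) \<Rightarrow> bool" where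
  "reliable pr f K \<rho> \<epsilon> fhat \<longleftrightarrow>
     fhat \<in> borel_measurable (PiM {1..K} (\<lambda>_. borel)) \<and>
     (\<forall>x\<in>signal_set pr.
        measure (sample_law (scheme pr) K (encode pr x))
          {\<omega> \<in> space (sample_law (scheme pr) K (encode pr x)). \<bar>fhat \<omega> - f x\<bar> \<le> \<rho>} \<ge> 1 - \<epsilon>)"

text \<open>The order of these lists is immaterial: reordering only permutes the rows and columns
  of the matrices below. List positions, hence matrix indices, start at 0.\<close>

definition upper_sets :: "('w, 'm, 'n) problem \<Rightarrow> real \<Rightarrow> 'n set list" where
  "upper_sets pr a = filter (\<lambda>Z. Z \<noteq> {})
     [part pr i \<inter> ge_rep pr a \<nu>. i \<leftarrow> [1..<Suc (num pr)], \<nu> \<leftarrow> [1..<Suc (ncvx pr)]]"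

definition lower_sets :: "('w, 'm, 'n) problem \<Rightarrow> real \<Rightarrow> 'n set list" where
  "lower_sets pr a = filter (\<lambda>Z. Z \<noteq> {})
     [part pr i \<inter> le_rep pr a \<nu>. i \<leftarrow> [1..<Suc (num pr)], \<nu> \<leftarrow> [1..<Suc (ncvx pr)]]"

definition upper_feasible :: "('w, 'm, 'n) problem \<Rightarrow> real \<Rightarrow> bool" where
  "upper_feasible pr a \<longleftrightarrow> length (upper_sets pr a) > 0"

definition lower_feasible :: "('w, 'm, 'n) problem \<Rightarrow> real \<Rightarrow> bool" where
  "lower_feasible pr a \<longleftrightarrow> length (lower_sets pr a) > 0"

definition maximizer ::
  "('w, 'm, 'n) problem \<Rightarrow> 'n set \<Rightarrow> 'n set \<Rightarrow> 'n \<times> 'n \<Rightarrow> bool" where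
  "maximizer pr Z Z' =
     is_arg_max (\<lambda>(r, s). ln (affinity (scheme pr) (encode pr r) (encode pr s)))
                (\<lambda>(r, s). r \<in> Z \<and> s \<in> Z')"

text \<open>The premise that a maximizer exists is there so that attainment of the maximum is not
  assumed along with the choice.\<close>

definition valid_selection :: "('w, 'm, 'n) problem \<Rightarrow> bool" where
  "valid_selection pr \<longleftrightarrow>
     (\<forall>a b i j. a < b \<and> i < length (upper_sets pr b) \<and> j < length (lower_sets pr a) \<and>
        (\<exists>rs. maximizer pr (upper_sets pr b ! i) (lower_sets pr a ! j) rs) \<longrightarrow>
        maximizer pr (upper_sets pr b ! i) (lower_sets pr a ! j) (sel pr a b i j))"

definition detector ::
  "('w, 'm, 'n) problem \<Rightarrow> real \<Rightarrow> real \<Rightarrow> nat \<Rightarrow> nat \<Rightarrow> 'w \<Rightarrow> real" where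
  "detector pr a b i j \<omega> =
     (let (r, s) = sel pr a b i j in
        1/2 * ln (dens (scheme pr) (encode pr r) \<omega> / dens (scheme pr) (encode pr s) \<omega>))"

definition detector_K ::
  "('w, 'm, 'n) problem \<Rightarrow> nat \<Rightarrow> real \<Rightarrow> real \<Rightarrow> nat \<Rightarrow> nat \<Rightarrow> (nat \<Rightarrow> 'w) \<Rightarrow> real" where
  "detector_K pr K a b i j \<omega> = (\<Sum>t = 1..K. detector pr a b i j (\<omega> t))"

definition pair_risk :: "('w, 'm, 'n) problem \<Rightarrow> real \<Rightarrow> real \<Rightarrow> nat \<Rightarrow> nat \<Rightarrow> real" where
  "pair_risk pr a b i j =
     (let (r, s) = sel pr a b i j in affinity (scheme pr) (encode pr r) (encode pr s))"

text \<open>An \<open>m \<times> n\<close> matrix is a function of which only the entries \<open>i < m\<close>, \<open>j < n\<close> matter.\<close>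

definition risk_matrix ::
  "('w, 'm, 'n) problem \<Rightarrow> nat \<Rightarrow> real \<Rightarrow> real \<Rightarrow> nat \<Rightarrow> nat \<Rightarrow> real" where
  "risk_matrix pr K a b i j = pair_risk pr a b i j ^ K"

definition spectral_norm :: "nat \<Rightarrow> nat \<Rightarrow> (nat \<Rightarrow> nat \<Rightarrow> real) \<Rightarrow> real" where
  "spectral_norm m n E =
     (SUP x\<in>{x. L2_set x {..<n} \<le> 1}. L2_set (\<lambda>i. \<Sum>j<n. E i j * x j) {..<m})"

text \<open>\<open>(g, h)\<close> is a Perron--Frobenius eigenvector, with eigenvalue \<open>spectral_norm m n E\<close>, of the
  symmetric block matrix with off-diagonal blocks \<open>E\<close> and its transpose.\<close>

definition perron_pair ::
  "nat \<Rightarrow> nat \<Rightarrow> (nat \<Rightarrow> nat \<Rightarrow> real) \<Rightarrow> (nat \<Rightarrow> real) \<times> (nat \<Rightarrow> real) \<Rightarrow> bool" where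
  "perron_pair m n E = (\<lambda>(g, h).
     (\<forall>i<m. g i > 0) \<and> (\<forall>j<n. h j > 0) \<and>
     (\<forall>i<m. spectral_norm m n E * g i = (\<Sum>j<n. E i j * h j)) \<and>
     (\<forall>j<n. spectral_norm m n E * h j = (\<Sum>i<m. E i j * g i)))"

datatype verdict = Right | Left

definition right_risk :: "('w, 'm, 'n) problem \<Rightarrow> nat \<Rightarrow> real \<Rightarrow> real \<Rightarrow> real" where
  "right_risk pr K a b =
     (if \<not> upper_feasible pr b then 0
      else spectral_norm (length (upper_sets pr b)) (length (lower_sets pr a))
             (risk_matrix pr K a b))"

text \<open>For a positive matrix the Perron--Frobenius eigenvector is unique up to a positive factor,
  which cancels in \<open>ln (g i) - ln (h j)\<close>; so the choice made below is immaterial.\<close>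

definition right_test ::
  "('w, 'm, 'n) problem \<Rightarrow> nat \<Rightarrow> real \<Rightarrow> real \<Rightarrow> (nat \<Rightarrow> 'w) \<Rightarrow> verdict" where
  "right_test pr K a b \<omega> =
     (if \<not> upper_feasible pr b then Left
      else
        let m = length (upper_sets pr b);
            n = length (lower_sets pr a);
            (g, h) = (SOME gh. perron_pair m n (risk_matrix pr K a b) gh);
            D = (\<lambda>i j. detector_K pr K a b i j \<omega> - ln (h j) + ln (g i))
        in if \<exists>i<m. \<forall>j<n. D i j \<ge> 0 then Right else Left)"

definition left_risk :: "('w, 'm, 'n) problem \<Rightarrow> nat \<Rightarrow> real \<Rightarrow> real \<Rightarrow> real" where
  "left_risk pr K a b = (if \<not> lower_feasible pr a then 0 else right_risk pr K a b)"

definition left_test ::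
  "('w, 'm, 'n) problem \<Rightarrow> nat \<Rightarrow> real \<Rightarrow> real \<Rightarrow> (nat \<Rightarrow> 'w) \<Rightarrow> verdict" where
  "left_test pr K a b \<omega> = (if \<not> lower_feasible pr a then Right else right_test pr K a b \<omega>)"

definition good_right :: "('w, 'm, 'n) problem \<Rightarrow> nat \<Rightarrow> real \<Rightarrow> real \<Rightarrow> real \<Rightarrow> bool" where
  "good_right pr K \<delta> a b \<longleftrightarrow> lower_feasible pr a \<and> b > a \<and> right_risk pr K a b \<le> \<delta>"

definition good_left :: "('w, 'm, 'n) problem \<Rightarrow> nat \<Rightarrow> real \<Rightarrow> real \<Rightarrow> real \<Rightarrow> bool" where
  "good_left pr K \<delta> a b \<longleftrightarrow> upper_feasible pr b \<and> b > a \<and> left_risk pr K a b \<le> \<delta>"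

text \<open>Endpoints found by the grid searches. They are used only if the candidate number 0 is
  good, so that the first failing candidate has a positive number.\<close>

definition right_end ::
  "('w, 'm, 'n) problem \<Rightarrow> nat \<Rightarrow> real \<Rightarrow> real \<Rightarrow> real \<Rightarrow> real \<Rightarrow> real" where
  "right_end pr K \<delta> \<kappa> c b =
     b - real ((LEAST k. \<not> good_right pr K \<delta> c (b - real k * \<kappa>)) - 1) * \<kappa>"

definition left_end ::
  "('w, 'm, 'n) problem \<Rightarrow> nat \<Rightarrow> real \<Rightarrow> real \<Rightarrow> real \<Rightarrow> real \<Rightarrow> real" where
  "left_end pr K \<delta> \<kappa> a c =
     a + real ((LEAST k. \<not> good_left pr K \<delta> (a + real k * \<kappa>) c) - 1) * \<kappa>"

text \<open>The argument of \<open>bisect\<close> following \<open>\<omega>\<close> is the number of steps still allowed;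
  segments \<open>[a, b]\<close> are pairs \<open>(a, b)\<close>.\<close>

fun bisect ::
  "('w, 'm, 'n) problem \<Rightarrow> nat \<Rightarrow> real \<Rightarrow> real \<Rightarrow> (nat \<Rightarrow> 'w) \<Rightarrow> nat \<Rightarrow> real \<times> real \<Rightarrow> real \<times> real"
where
  "bisect pr K \<delta> \<kappa> \<omega> 0 (a, b) = (a, b)"
| "bisect pr K \<delta> \<kappa> \<omega> (Suc l) (a, b) =
     (let c = (a + b) / 2 in
      if \<not> upper_feasible pr c then bisect pr K \<delta> \<kappa> \<omega> l (a, c)
      else if \<not> lower_feasible pr c then bisect pr K \<delta> \<kappa> \<omega> l (c, b)
      else if \<not> good_right pr K \<delta> c b then (a, b)
      else if \<not> good_left pr K \<delta> a c then (a, b)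
      else
        let v = right_end pr K \<delta> \<kappa> c b;
            u = left_end pr K \<delta> \<kappa> a c
        in if right_test pr K c v \<omega> = left_test pr K u c \<omega>
           then (case right_test pr K c v \<omega> of
                   Right \<Rightarrow> bisect pr K \<delta> \<kappa> \<omega> l (c, b)
                 | Left \<Rightarrow> bisect pr K \<delta> \<kappa> \<omega> l (a, c))
           else (u, v))"

definition midpoint_estimate ::
  "('w, 'm, 'n) problem \<Rightarrow> nat \<Rightarrow> nat \<Rightarrow> real \<Rightarrow> real \<Rightarrow> real \<Rightarrow> real \<Rightarrow> (nat \<Rightarrow> 'w) \<Rightarrow> real" where
  "midpoint_estimate pr K L \<delta> \<kappa> a0 b0 \<omega> =
     (let (u, v) = bisect pr K \<delta> \<kappa> \<omega> L (a0, b0) in (u + v) / 2)"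

end

theory Submission
  imports Defs "HOL-Probability.Infinite_Product_Measure"
begin

text \<open>
  Let \<open>(r, s)\<close> maximize the affinity over a pair of convex compact sets. Concavity of \<open>Phi\<close> in the
  parameter makes \<open>(r, s)\<close> a saddle point: the detector \<open>\<phi> = 1/2 ln (p\<^sub>r / p\<^sub>s)\<close> has
  moments \<open>\<integral> exp (- \<phi>) p\<close> and \<open>\<integral> exp \<phi> p\<close> at most the maximal affinity under all densities of the
  first and of the second set. Chernoff bounds, weighted by the Perron--Frobenius vector, then bound
  both error probabilities of a test by the spectral norm of its risk matrix, and a union bound over
  the at most \<open>L\<close> steps gives reliability.

  Conversely, an estimate that is \<open>(\<rho>', \<epsilon>)\<close>-reliable with \<open>k\<close> observations separates signals whose
  values differ by more than \<open>2 \<rho>'\<close>, which forces their affinity to satisfy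
  \<open>affinity ^ k \<le> 2 sqrt (\<epsilon> (1 - \<epsilon>))\<close>. With \<open>K\<close> observations every segment longer than \<open>2 \<rho>'\<close>
  is therefore good, so the segments \<open>[u, c]\<close> and \<open>[c, v]\<close> of a terminating step have length at
  most \<open>\<rho>\<close>.
\<close>

subsection \<open>Integrals, affinities and product measures\<close>

text \<open>The constants come from counting. Every step runs two tests of risk at most
  \<open>\<delta>\<close>, so \<open>L\<close> steps cost
  \<open>2 * L * \<delta> = \<epsilon>\<close>. A risk matrix has at most \<open>N * I\<close> rows
  and columns, so its norm is at most \<open>N * I\<close> times its largest entry. For signals that
  the given estimate separates, the entries are at most
  \<open>(4 * \<epsilon> * (1 - \<epsilon>)) powr (K / (2 * k))\<close>, and asking that this be at
  most \<open>\<delta> / (N * I)\<close> is the formula for \<open>K\<close>. A maximal segment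
  shortened by \<open>\<kappa>\<close> is no longer good, so its length is at most
  \<open>2 * \<rho>' + \<kappa>\<close>, which the choice of \<open>\<kappa>\<close> turns into
  \<open>\<rho>\<close>. Two obstacles shape the proof. No differentiability of \<open>Phi\<close>
  and no dominating function are given, so first-order conditions are replaced by inequalities along
  a segment and a limit by Fatou's lemma. And the segments visited by Bisection are random; the
  union bound therefore follows, at each step, only a half containing \<open>f x\<close>, since
  entering a half without it is already an error.\<close>

lemma integral_sqrt_mult:
  fixes f g :: "'a \<Rightarrow> real"
  assumes f: "integrable M f" and g: "integrable M g"
    and f0: "\<And>x. 0 \<le> f x" and g0: "\<And>x. 0 \<le> g x"
  shows integrable_sqrt_mult: "integrable M (\<lambda>x. sqrt (f x * g x))"
    and integral_sqrt_mult_le: "(\<integral>x. sqrt (f x * g x) \<partial>M)\<^sup>2 \<le> (\<integral>x. f x \<partial>M) * (\<integral>x. g x \<partial>M)"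
proof -
  have [measurable]: "f \<in> borel_measurable M" "g \<in> borel_measurable M"
    using f g by auto
  show int: "integrable M (\<lambda>x. sqrt (f x * g x))"
  proof (rule Bochner_Integration.integrable_bound)
    show "integrable M (\<lambda>x. f x + g x)"
      using f g by simp
    have "sqrt (f x * g x) \<le> f x + g x" for x
      using arith_geo_mean_sqrt[OF f0 g0, of x x] f0[of x] g0[of x] by simp
    then show "AE x in M. norm (sqrt (f x * g x)) \<le> norm (f x + g x)"
      using f0 g0 by (intro AE_I2) (simp add: add_nonneg_nonneg)
  qed simp
  have "(\<integral>\<^sup>+x. ennreal (sqrt (f x)) * ennreal (sqrt (g x)) \<partial>M)\<^sup>2
      \<le> (\<integral>\<^sup>+x. ennreal (sqrt (f x)) ^ 2 \<partial>M) * (\<integral>\<^sup>+x. ennreal (sqrt (g x)) ^ 2 \<partial>M)"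
    by (rule Cauchy_Schwarz_nn_integral) simp_all
  moreover have "(\<integral>\<^sup>+x. ennreal (sqrt (f x)) * ennreal (sqrt (g x)) \<partial>M)
      = ennreal (\<integral>x. sqrt (f x * g x) \<partial>M)"
    using f0 g0 int
    by (subst nn_integral_eq_integral[symmetric]) (auto simp: real_sqrt_mult ennreal_mult)
  moreover have "(\<integral>\<^sup>+x. ennreal (sqrt (f x)) ^ 2 \<partial>M) = ennreal (\<integral>x. f x \<partial>M)"
    using f0 f by (subst nn_integral_eq_integral[symmetric]) (auto simp: ennreal_power)
  moreover have "(\<integral>\<^sup>+x. ennreal (sqrt (g x)) ^ 2 \<partial>M) = ennreal (\<integral>x. g x \<partial>M)"
    using g0 g by (subst nn_integral_eq_integral[symmetric]) (auto simp: ennreal_power)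
  ultimately have "ennreal ((\<integral>x. sqrt (f x * g x) \<partial>M)\<^sup>2) \<le> ennreal ((\<integral>x. f x \<partial>M) * (\<integral>x. g x \<partial>M))"
    using f0 g0 by (simp add: ennreal_power ennreal_mult Bochner_Integration.integral_nonneg)
  then show "(\<integral>x. sqrt (f x * g x) \<partial>M)\<^sup>2 \<le> (\<integral>x. f x \<partial>M) * (\<integral>x. g x \<partial>M)"
    using f0 g0 by (subst (asm) ennreal_le_iff) (auto simp: Bochner_Integration.integral_nonneg)
qed

text \<open>The bounds \<open>c n\<close> may vary because this serves two purposes: with constant
  bounds it passes to the limit in the moments of detectors, and with bounds that converge along a
  maximizing sequence it shows that the affinity attains its maximum.\<close>

lemma Fatou_real:
  fixes f :: "nat \<Rightarrow> 'a \<Rightarrow> real"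
  assumes int: "\<And>n. integrable M (f n)" and nn: "\<And>n x. 0 \<le> f n x"
    and lim: "\<And>x. (\<lambda>n. f n x) \<longlonglongrightarrow> g x"
    and bnd: "\<And>n. integral\<^sup>L M (f n) \<le> c n" and c: "c \<longlonglongrightarrow> C"
  shows "integrable M g" and "integral\<^sup>L M g \<le> C"
proof -
  have [measurable]: "f n \<in> borel_measurable M" for n
    using int by auto
  have [measurable]: "g \<in> borel_measurable M"
    by (rule borel_measurable_LIMSEQ_real[where u=f]) (use lim in simp_all)
  have g0: "0 \<le> g x" for x
    by (rule LIMSEQ_le_const[OF lim]) (use nn in simp)
  have "C \<ge> 0"
    using c by (rule LIMSEQ_le_const)
      (use order_trans[OF Bochner_Integration.integral_nonneg bnd] nn in blast)
  have "(\<integral>\<^sup>+x. ennreal (g x) \<partial>M) = (\<integral>\<^sup>+x. liminf (\<lambda>n. ennreal (f n x)) \<partial>M)"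
    using lim by (intro nn_integral_cong lim_imp_Liminf[symmetric] tendsto_ennrealI) auto
  also have "\<dots> \<le> liminf (\<lambda>n. \<integral>\<^sup>+x. ennreal (f n x) \<partial>M)"
    by (rule nn_integral_liminf) simp
  also have "\<dots> \<le> liminf (\<lambda>n. ennreal (c n))"
    using bnd nn by (intro Liminf_mono always_eventually allI)
      (subst nn_integral_eq_integral[OF int], auto intro: ennreal_leI)
  also have "\<dots> = ennreal C"
    using c by (intro lim_imp_Liminf tendsto_ennrealI) auto
  finally have le: "(\<integral>\<^sup>+x. ennreal (g x) \<partial>M) \<le> ennreal C" .
  show int_g: "integrable M g"
    using g0 le by (intro integrableI_nonneg) (auto simp: le_less_trans)
  show "integral\<^sup>L M g \<le> C"
    using le g0 \<open>C \<ge> 0\<close> by (simp add: nn_integral_eq_integral[OF int_g])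
qed

text \<open>\<open>S\<close> is the region where a test accepts \<open>p\<close> against
  \<open>q\<close>, with error probabilities \<open>\<alpha>\<close> and \<open>\<beta>\<close>. The
  Hellinger affinity is split over \<open>S\<close> and its complement, and Cauchy-Schwarz on each
  part bounds it by \<open>sqrt ((1 - \<alpha>) * \<beta>) + sqrt (\<alpha> * (1 -
  \<beta>))\<close>.\<close>

lemma affinity_le_of_test:
  fixes p q :: "'a \<Rightarrow> real"
  assumes p: "integrable M p" "\<And>x. 0 \<le> p x" "integral\<^sup>L M p = 1"
    and q: "integrable M q" "\<And>x. 0 \<le> q x" "integral\<^sup>L M q = 1"
    and S: "S \<in> sets M" and e: "e \<le> 1/2"
    and pS: "(\<integral>x. p x * indicator S x \<partial>M) \<ge> 1 - e"
    and qS: "(\<integral>x. q x * indicator S x \<partial>M) \<le> e"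
  shows "(\<integral>x. sqrt (p x * q x) \<partial>M)\<^sup>2 \<le> 4 * e * (1 - e)"
proof -
  note [measurable] = S
  define \<alpha> where "\<alpha> = 1 - (\<integral>x. p x * indicator S x \<partial>M)"
  define \<beta> where "\<beta> = (\<integral>x. q x * indicator S x \<partial>M)"
  have ind: "integrable M (\<lambda>x. r x * indicator T x)" if "integrable M r" "T \<in> sets M" for r :: "'a \<Rightarrow> real" and T
    using integrable_mult_indicator[OF that(2,1)] by (simp add: mult.commute)
  have split: "r x = r x * indicator S x + r x * indicator (space M - S) x" if "x \<in> space M" for r :: "'a \<Rightarrow> real" and x
    using that by (auto simp: indicator_def)
  have isplit: "integral\<^sup>L M r = (\<integral>x. r x * indicator S x \<partial>M) + (\<integral>x. r x * indicator (space M - S) x \<partial>M)"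
    if "integrable M r" for r :: "'a \<Rightarrow> real"
  proof -
    have "integral\<^sup>L M r = (\<integral>x. r x * indicator S x + r x * indicator (space M - S) x \<partial>M)"
      by (intro Bochner_Integration.integral_cong refl split)
    also have "\<dots> = (\<integral>x. r x * indicator S x \<partial>M) + (\<integral>x. r x * indicator (space M - S) x \<partial>M)"
      using that S by (intro Bochner_Integration.integral_add ind) auto
    finally show ?thesis .
  qed
  have pc: "(\<integral>x. p x * indicator (space M - S) x \<partial>M) = \<alpha>"
    and qc: "(\<integral>x. q x * indicator (space M - S) x \<partial>M) = 1 - \<beta>"
    using isplit[OF p(1)] isplit[OF q(1)] p q by (auto simp: \<alpha>_def \<beta>_def)
  have "0 \<le> \<alpha>"
    unfolding pc[symmetric] using p by (intro Bochner_Integration.integral_nonneg) auto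
  moreover have "0 \<le> \<beta>"
    unfolding \<beta>_def using q by (intro Bochner_Integration.integral_nonneg) auto
  ultimately have a: "0 \<le> \<alpha>" "0 \<le> \<beta>" "\<alpha> \<le> e" "\<beta> \<le> e"
    using pS qS by (auto simp: \<alpha>_def \<beta>_def)
  have cs: "(\<integral>x. sqrt (p x * q x) * indicator T x \<partial>M)
      \<le> sqrt ((\<integral>x. p x * indicator T x \<partial>M) * (\<integral>x. q x * indicator T x \<partial>M))"
    if T: "T \<in> sets M" for T
  proof -
    have "(\<integral>x. sqrt ((p x * indicator T x) * (q x * indicator T x)) \<partial>M)\<^sup>2
       \<le> (\<integral>x. p x * indicator T x \<partial>M) * (\<integral>x. q x * indicator T x \<partial>M)"
      using p q T by (intro integral_sqrt_mult_le ind) auto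
    moreover have "(\<integral>x. sqrt ((p x * indicator T x) * (q x * indicator T x)) \<partial>M)
      = (\<integral>x. sqrt (p x * q x) * indicator T x \<partial>M)"
      by (intro Bochner_Integration.integral_cong) (auto simp: indicator_def)
    ultimately show ?thesis
      by (simp add: real_le_rsqrt)
  qed
  define u v where "u = sqrt ((1 - \<alpha>) * \<beta>)" and "v = sqrt (\<alpha> * (1 - \<beta>))"
  have "(\<integral>x. sqrt (p x * q x) \<partial>M) \<le> u + v"
    unfolding isplit[OF integrable_sqrt_mult[OF p(1) q(1) p(2) q(2)]]
    using cs[of S] cs[of "space M - S"] S unfolding pc qc u_def v_def
    by (auto simp: \<alpha>_def \<beta>_def)
  moreover have "0 \<le> (\<integral>x. sqrt (p x * q x) \<partial>M)"
    using p q by (intro Bochner_Integration.integral_nonneg) auto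
  ultimately have "(\<integral>x. sqrt (p x * q x) \<partial>M)\<^sup>2 \<le> (u + v)\<^sup>2"
    by (rule power_mono)
  also have "(u + v)\<^sup>2 \<le> 1 - (1 - \<alpha> - \<beta>)\<^sup>2"
  proof -
    have u2: "u\<^sup>2 = (1 - \<alpha>) * \<beta>" and v2: "v\<^sup>2 = \<alpha> * (1 - \<beta>)"
      using a e by (auto simp: u_def v_def)
    \<comment> \<open>Regrouping the four factors before the arithmetic-geometric mean inequality
      makes the resulting bound depend on \<open>\<alpha> + \<beta>\<close> only.\<close>
    have "u * v = sqrt (\<alpha> * (1 - \<alpha>)) * sqrt (\<beta> * (1 - \<beta>))"
      by (simp add: u_def v_def real_sqrt_mult)
    also have "2 * \<dots> \<le> \<alpha> * (1 - \<alpha>) + \<beta> * (1 - \<beta>)"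
      using sum_squares_bound[of "sqrt (\<alpha> * (1 - \<alpha>))" "sqrt (\<beta> * (1 - \<beta>))"] a e by simp
    finally show ?thesis
      unfolding power2_sum u2 v2 by (simp add: power2_eq_square algebra_simps)
  qed
  \<comment> \<open>Squaring preserves the order here because \<open>e \<le> 1/2\<close> makes
    \<open>1 - 2 * e\<close> nonnegative.\<close>
  also have "\<dots> \<le> 1 - (1 - 2 * e)\<^sup>2"
    using a e by (intro diff_left_mono power_mono) auto
  also have "\<dots> = 4 * e * (1 - e)"
    by (simp add: power2_eq_square algebra_simps)
  finally show ?thesis .
qed

text \<open>This turns the law of a repeated observation into one density against the product of the
  reference measures, so that the two-point bound \<open>affinity_le_of_test\<close> applies to it.
  Measures on the product are compared on boxes, where the integral factorizes.\<close>

lemma PiM_density: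
  fixes p :: "'i \<Rightarrow> 'a \<Rightarrow> ennreal"
  assumes I: "finite I" and M: "product_sigma_finite M"
    and D: "product_sigma_finite (\<lambda>i. density (M i) (p i))"
    and p[measurable]: "\<And>i. p i \<in> borel_measurable (M i)"
  shows "PiM I (\<lambda>i. density (M i) (p i)) = density (PiM I M) (\<lambda>x. \<Prod>i\<in>I. p i (x i))"
proof -
  interpret M: product_sigma_finite M by (rule M)
  interpret D: product_sigma_finite "\<lambda>i. density (M i) (p i)" by (rule D)
  have prodm[measurable]: "(\<lambda>x. \<Prod>i\<in>I. p i (x i)) \<in> borel_measurable (PiM I M)"
    by measurable
  show ?thesis
  proof (rule D.PiM_eqI[symmetric])
    show "sets (density (PiM I M) (\<lambda>x. \<Prod>i\<in>I. p i (x i))) = sets (PiM I (\<lambda>i. density (M i) (p i)))"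
      by (simp cong: sets_PiM_cong)
  next
    fix A assume "\<And>i. i \<in> I \<Longrightarrow> A i \<in> sets (density (M i) (p i))"
    then have A: "\<And>i. i \<in> I \<Longrightarrow> A i \<in> sets (M i)" by simp
    have "emeasure (density (PiM I M) (\<lambda>x. \<Prod>i\<in>I. p i (x i))) (Pi\<^sub>E I A)
        = (\<integral>\<^sup>+x. (\<Prod>i\<in>I. p i (x i)) * indicator (Pi\<^sub>E I A) x \<partial>PiM I M)"
      using A I by (subst emeasure_density) (auto intro!: sets_PiM_I_finite)
    also have "\<dots> = (\<integral>\<^sup>+x. (\<Prod>i\<in>I. p i (x i) * indicator (A i) (x i)) \<partial>PiM I M)"
    proof (rule nn_integral_cong)
      fix x assume "x \<in> space (PiM I M)"
      then have "indicator (Pi\<^sub>E I A) x = (\<Prod>i\<in>I. indicator (A i) (x i) :: ennreal)"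
        using I by (auto simp: indicator_def space_PiM PiE_iff)
      then show "(\<Prod>i\<in>I. p i (x i)) * indicator (Pi\<^sub>E I A) x = (\<Prod>i\<in>I. p i (x i) * indicator (A i) (x i))"
        by (simp add: prod.distrib)
    qed
    also have "\<dots> = (\<Prod>i\<in>I. \<integral>\<^sup>+x. p i x * indicator (A i) x \<partial>M i)"
      using A I by (intro M.product_nn_integral_prod) auto
    also have "\<dots> = (\<Prod>i\<in>I. emeasure (density (M i) (p i)) (A i))"
      using A by (intro prod.cong) (auto simp: emeasure_density)
    finally show "emeasure (density (PiM I M) (\<lambda>x. \<Prod>i\<in>I. p i (x i))) (Pi\<^sub>E I A)
        = (\<Prod>i\<in>I. emeasure (density (M i) (p i)) (A i))" .
  qed (rule I)
qed

subsection \<open>Spectral norms and Perron--Frobenius pairs\<close>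

abbreviation mat_vec :: "nat \<Rightarrow> (nat \<Rightarrow> nat \<Rightarrow> real) \<Rightarrow> (nat \<Rightarrow> real) \<Rightarrow> nat \<Rightarrow> real" where
  "mat_vec n E x \<equiv> \<lambda>i. \<Sum>j<n. E i j * x j"

lemma sum_mult_le_L2_set: "(\<Sum>i\<in>A. f i * g i) \<le> L2_set f A * L2_set g A"
proof -
  have "(\<Sum>i\<in>A. f i * g i) \<le> (\<Sum>i\<in>A. \<bar>f i\<bar> * \<bar>g i\<bar>)"
    by (intro sum_mono) (simp flip: abs_mult)
  then show ?thesis
    using L2_set_mult_ineq[of f g A] by linarith
qed

lemma power2_L2_set: "(L2_set f A)\<^sup>2 = (\<Sum>i\<in>A. (f i)\<^sup>2)"
  by (simp add: L2_set_def sum_nonneg)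

lemma L2_set_abs: "L2_set (\<lambda>i. \<bar>f i\<bar>) A = L2_set f A"
  by (simp add: L2_set_def)

lemma L2_mat_vec_le:
  fixes C :: real
  assumes C: "\<And>i j. i < m \<Longrightarrow> j < n \<Longrightarrow> \<bar>E i j\<bar> \<le> C"
    and x: "L2_set x {..<n} \<le> 1" and C0: "0 \<le> C"
  shows "L2_set (mat_vec n E x) {..<m} \<le> sqrt (real (m * n)) * C"
proof -
  have "\<bar>mat_vec n E x i\<bar> \<le> sqrt (real n) * C" if i: "i < m" for i
  proof -
    have "\<bar>mat_vec n E x i\<bar> \<le> (\<Sum>j<n. \<bar>E i j\<bar> * \<bar>x j\<bar>)"
      using sum_abs[of "\<lambda>j. E i j * x j" "{..<n}"] by (simp add: abs_mult)
    also have "\<dots> \<le> L2_set (E i) {..<n} * L2_set x {..<n}"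
      by (rule L2_set_mult_ineq)
    also have "\<dots> \<le> L2_set (E i) {..<n}"
      using mult_left_mono[OF x, of "L2_set (E i) {..<n}"] by simp
    also have "\<dots> = L2_set (\<lambda>j. \<bar>E i j\<bar>) {..<n}"
      by (simp add: L2_set_def)
    also have "\<dots> \<le> L2_set (\<lambda>j. C) {..<n}"
      using i C by (intro L2_set_mono) auto
    also have "\<dots> = sqrt (real n) * C"
      using C0 by (simp add: L2_set_constant)
    finally show ?thesis .
  qed
  then have "L2_set (\<lambda>i. \<bar>mat_vec n E x i\<bar>) {..<m} \<le> L2_set (\<lambda>i. sqrt (real n) * C) {..<m}"
    by (intro L2_set_mono) auto
  then show ?thesis
    using C0 by (simp add: L2_set_constant L2_set_def real_sqrt_mult)
qed

text \<open>The right-hand side is the Frobenius norm of the matrix with all entries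
  \<open>C\<close>. This is where the factor \<open>N * I\<close> inside the logarithm of
  \<open>K\<close> originates.\<close>

lemma spectral_norm_le:
  assumes "\<And>i j. i < m \<Longrightarrow> j < n \<Longrightarrow> \<bar>E i j\<bar> \<le> C" and "0 \<le> C"
  shows "spectral_norm m n E \<le> sqrt (real (m * n)) * C"
  unfolding spectral_norm_def
proof (rule cSUP_least)
  show "{x. L2_set x {..<n} \<le> 1} \<noteq> {}"
    by (auto simp: L2_set_def intro!: exI[of _ "\<lambda>_. 0"])
qed (use assms L2_mat_vec_le in auto)

lemma L2_mat_vec_le_spectral_norm_unit:
  assumes "L2_set x {..<n} \<le> 1"
  shows "L2_set (mat_vec n E x) {..<m} \<le> spectral_norm m n E"
  unfolding spectral_norm_def
proof (rule cSUP_upper)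
  \<comment> \<open>Any common bound of the entries will do: it only certifies that the supremum is
    over a set bounded above.\<close>
  define C where "C = (\<Sum>i<m. \<Sum>j<n. \<bar>E i j\<bar>)"
  have C: "\<bar>E i j\<bar> \<le> C" if "i < m" "j < n" for i j
  proof -
    have "\<bar>E i j\<bar> \<le> (\<Sum>j<n. \<bar>E i j\<bar>)"
      using that by (intro member_le_sum) auto
    also have "\<dots> \<le> C"
      unfolding C_def using that by (intro member_le_sum[where f="\<lambda>i. \<Sum>j<n. \<bar>E i j\<bar>"]) (auto simp: sum_nonneg)
    finally show ?thesis .
  qed
  have "0 \<le> C"
    by (simp add: C_def sum_nonneg)
  then show "bdd_above ((\<lambda>x. L2_set (mat_vec n E x) {..<m}) ` {x. L2_set x {..<n} \<le> 1})"
    using L2_mat_vec_le[of m n E C] C by (intro bdd_aboveI2[where M="sqrt (real (m * n)) * C"]) auto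
qed (use assms in simp)

lemma L2_mat_vec_le_spectral_norm:
  "L2_set (mat_vec n E x) {..<m} \<le> spectral_norm m n E * L2_set x {..<n}"
proof (cases "L2_set x {..<n} = 0")
  case True
  then have "\<And>j. j < n \<Longrightarrow> x j = 0"
    by (simp add: L2_set_eq_0_iff)
  then have "L2_set (mat_vec n E x) {..<m} = 0"
    by (simp add: L2_set_eq_0_iff)
  with True show ?thesis by simp
next
  case False
  define c where "c = L2_set x {..<n}"
  have c: "0 < c"
    using False L2_set_nonneg[of x "{..<n}"] by (simp add: c_def order_less_le)
  have "L2_set (\<lambda>j. (1 / c) * x j) {..<n} = 1"
    using c by (subst L2_set_right_distrib[symmetric]) (auto simp: c_def)
  then have "L2_set (mat_vec n E (\<lambda>j. (1 / c) * x j)) {..<m} \<le> spectral_norm m n E"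
    by (intro L2_mat_vec_le_spectral_norm_unit) simp
  moreover have "mat_vec n E (\<lambda>j. (1 / c) * x j) = (\<lambda>i. (1 / c) * mat_vec n E x i)"
    by (auto simp: sum_distrib_left algebra_simps)
  ultimately have "(1 / c) * L2_set (mat_vec n E x) {..<m} \<le> spectral_norm m n E"
    using c by (simp add: L2_set_right_distrib del: times_divide_eq_left)
  then show ?thesis
    using c by (simp add: c_def field_simps)
qed

text \<open>Vectors are functions on all of \<open>nat\<close>, and coordinates from
  \<open>n\<close> on are unconstrained, so the unit ball itself is not compact. Cutting these
  coordinates to 0 puts the ball into the Tychonoff cube \<open>B\<close> and changes neither
  norm.\<close>

lemma spectral_norm_attained:
  obtains x where "L2_set x {..<n} \<le> 1" "L2_set (mat_vec n E x) {..<m} = spectral_norm m n E"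
proof -
  define B where "B = (PiE UNIV (\<lambda>j. if j < n then {-1..1} else {0}) :: (nat \<Rightarrow> real) set)"
  have cont: "continuous_on UNIV (\<lambda>x :: nat \<Rightarrow> real. x j)" for j
    by (rule continuous_on_product_coordinates)
  have "compactin (product_topology (\<lambda>_. euclidean) UNIV) B"
    unfolding B_def by (subst compactin_PiE) auto
  then have "compact B"
    by (simp add: euclidean_product_topology)
  moreover have "closed {x :: nat \<Rightarrow> real. L2_set x {..<n} \<le> 1}"
    unfolding L2_set_def by (intro closed_Collect_le continuous_intros cont)
  ultimately have S: "compact (B \<inter> {x. L2_set x {..<n} \<le> 1})"
    by (rule compact_Int_closed)
  have "(\<lambda>_. 0) \<in> B \<inter> {x. L2_set x {..<n} \<le> 1}"
    by (auto simp: B_def L2_set_def PiE_iff)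
  moreover have "continuous_on (B \<inter> {x. L2_set x {..<n} \<le> 1}) (\<lambda>x. L2_set (mat_vec n E x) {..<m})"
    unfolding L2_set_def by (intro continuous_intros continuous_on_subset[OF cont]) auto
  ultimately obtain x where x: "x \<in> B" "L2_set x {..<n} \<le> 1"
    and max: "\<And>y. y \<in> B \<Longrightarrow> L2_set y {..<n} \<le> 1 \<Longrightarrow>
      L2_set (mat_vec n E y) {..<m} \<le> L2_set (mat_vec n E x) {..<m}"
    using continuous_attains_sup[OF S] by blast
  have "L2_set (mat_vec n E y) {..<m} \<le> L2_set (mat_vec n E x) {..<m}" if y: "L2_set y {..<n} \<le> 1" for y
  proof -
    define y' where "y' j = (if j < n then y j else 0)" for j
    have L: "L2_set y' {..<n} = L2_set y {..<n}"
      by (intro L2_set_cong) (auto simp: y'_def)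
    have "\<bar>y j\<bar> \<le> 1" if "j < n" for j
      using member_le_L2_set[of "{..<n}" j "\<lambda>j. \<bar>y j\<bar>"] y that by (simp add: L2_set_abs)
    then have "y' \<in> B"
      by (auto simp: B_def y'_def PiE_iff abs_le_iff minus_le_iff)
    then have "L2_set (mat_vec n E y') {..<m} \<le> L2_set (mat_vec n E x) {..<m}"
      using L y by (intro max) auto
    moreover have "mat_vec n E y' = mat_vec n E y"
      by (auto simp: y'_def)
    ultimately show ?thesis by simp
  qed
  then have "spectral_norm m n E \<le> L2_set (mat_vec n E x) {..<m}"
    unfolding spectral_norm_def using x by (intro cSUP_least) auto
  then show ?thesis
    using x L2_mat_vec_le_spectral_norm_unit[of x n E m] that by force
qed

text \<open>A unit vector \<open>h \<ge> 0\<close> that maximizes the norm of \<open>E h\<close> and the normalized image \<open>g\<close> of \<open>h\<close>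
  form the pair: equality in the Cauchy--Schwarz inequality gives the second eigenvector equation,
  and positivity of \<open>E\<close> spreads to \<open>g\<close> and then to \<open>h\<close>.\<close>

lemma perron_pair_exists:
  assumes m: "0 < m" and n: "0 < n" and E: "\<And>i j. i < m \<Longrightarrow> j < n \<Longrightarrow> 0 < E i j"
  obtains g h where "perron_pair m n E (g, h)"
proof -
  define \<sigma> where "\<sigma> = spectral_norm m n E"
  obtain x where x: "L2_set x {..<n} \<le> 1" "L2_set (mat_vec n E x) {..<m} = \<sigma>"
    unfolding \<sigma>_def by (rule spectral_norm_attained)
  define h where "h j = \<bar>x j\<bar>" for j
  have h1: "L2_set h {..<n} \<le> 1"
    using x by (simp add: h_def L2_set_def)
  have "L2_set (\<lambda>i. \<bar>mat_vec n E x i\<bar>) {..<m} \<le> L2_set (mat_vec n E h) {..<m}"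
  proof (rule L2_set_mono)
    fix i assume "i \<in> {..<m}"
    then have "(\<Sum>j<n. \<bar>E i j * x j\<bar>) = mat_vec n E h i"
      using E[of i] by (intro sum.cong) (auto simp: h_def abs_mult abs_of_pos)
    then show "\<bar>mat_vec n E x i\<bar> \<le> mat_vec n E h i"
      using sum_abs[of "\<lambda>j. E i j * x j" "{..<n}"] by simp
  qed simp
  then have hge: "\<sigma> \<le> L2_set (mat_vec n E h) {..<m}"
    using x(2) by (simp add: L2_set_abs)
  have hs: "L2_set (mat_vec n E h) {..<m} = \<sigma>"
    using L2_mat_vec_le_spectral_norm_unit[OF h1, of E m] hge by (simp add: \<sigma>_def)
  \<comment> \<open>The first unit vector already gives norm at least \<open>E 0 0\<close>.\<close>
  have spos: "0 < \<sigma>"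
  proof -
    define e where "e j = (if j = 0 then 1 else 0 :: real)" for j :: nat
    have "L2_set e {..<n} \<le> 1"
      using n by (simp add: e_def L2_set_def if_distrib[of "\<lambda>t. t\<^sup>2"] cong: if_cong)
    then have "L2_set (mat_vec n E e) {..<m} \<le> \<sigma>"
      unfolding \<sigma>_def by (rule L2_mat_vec_le_spectral_norm_unit)
    moreover have "mat_vec n E e 0 \<le> L2_set (mat_vec n E e) {..<m}"
      using m by (intro member_le_L2_set) auto
    moreover have "mat_vec n E e 0 = E 0 0"
      using n by (simp add: e_def if_distrib[of "\<lambda>t. _ * t"] cong: if_cong)
    ultimately show ?thesis
      using E[OF m n] by linarith
  qed
  define g where "g i = mat_vec n E h i / \<sigma>" for i
  have g1: "L2_set g {..<m} = 1"
    using hs spos L2_set_right_distrib[of "1/\<sigma>" "mat_vec n E h" "{..<m}"]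
    by (simp add: g_def[abs_def])
  have gE: "\<sigma> * g i = mat_vec n E h i" for i
    using spos by (simp add: g_def)
  \<comment> \<open>\<open>w\<close> is the transpose of \<open>E\<close> applied to
    \<open>g\<close>; what remains of the eigenvector equations is
    \<open>w = \<sigma> h\<close>.\<close>
  define w where "w j = (\<Sum>i<m. E i j * g i)" for j
  have dual: "(\<Sum>j<n. w j * y j) = (\<Sum>i<m. g i * mat_vec n E y i)" for y
    unfolding w_def sum_distrib_left sum_distrib_right
    by (subst sum.swap) (simp add: algebra_simps)
  have wle: "(\<Sum>j<n. w j * y j) \<le> \<sigma> * L2_set y {..<n}" for y
  proof -
    have "(\<Sum>j<n. w j * y j) \<le> L2_set g {..<m} * L2_set (mat_vec n E y) {..<m}"
      unfolding dual by (rule sum_mult_le_L2_set)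
    then show ?thesis
      using g1 L2_mat_vec_le_spectral_norm[where n=n and E=E and x=y and m=m] by (simp add: \<sigma>_def)
  qed
  have w\<sigma>: "L2_set w {..<n} \<le> \<sigma>"
  proof -
    have "L2_set w {..<n} * L2_set w {..<n} \<le> \<sigma> * L2_set w {..<n}"
      using wle[of w] power2_L2_set[of w "{..<n}"] by (simp add: power2_eq_square)
    then show ?thesis
      using spos L2_set_nonneg[of w "{..<n}"] by (cases "L2_set w {..<n} = 0") auto
  qed
  have wh: "(\<Sum>j<n. w j * h j) = \<sigma>"
  proof -
    have "(\<Sum>i<m. g i * mat_vec n E h i) = \<sigma> * (\<Sum>i<m. (g i)\<^sup>2)"
      by (simp add: gE[symmetric] power2_eq_square mult.left_commute flip: sum_distrib_left)
    then show ?thesis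
      unfolding dual power2_L2_set[symmetric] g1 by simp
  qed
  \<comment> \<open>The equality case of Cauchy-Schwarz by expanding a square: \<open>w\<close> has
    norm at most \<open>\<sigma>\<close>, \<open>h\<close> at most 1, and their inner product is
    exactly \<open>\<sigma>\<close>.\<close>
  have "(\<Sum>j<n. (w j - \<sigma> * h j)\<^sup>2) = (\<Sum>j<n. (w j)\<^sup>2) - 2 * \<sigma> * (\<Sum>j<n. w j * h j) + \<sigma>\<^sup>2 * (\<Sum>j<n. (h j)\<^sup>2)"
    by (simp add: power2_diff sum.distrib sum_subtractf sum_distrib_left power_mult_distrib algebra_simps)
  also have "\<dots> \<le> \<sigma>\<^sup>2 - 2 * \<sigma> * \<sigma> + \<sigma>\<^sup>2 * 1"
    unfolding wh power2_L2_set[symmetric]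
    using w\<sigma> h1 spos by (intro add_mono diff_mono mult_left_mono) (auto intro: power_mono simp: power_le_one)
  also have "\<dots> = 0"
    by (simp add: power2_eq_square)
  finally have "(\<Sum>j<n. (w j - \<sigma> * h j)\<^sup>2) = 0"
    by (simp add: order_antisym sum_nonneg)
  then have hE: "\<sigma> * h j = w j" if "j < n" for j
    using that by (simp add: sum_nonneg_eq_0_iff)
  have "\<exists>j0<n. h j0 \<noteq> 0"
  proof (rule ccontr)
    assume "\<not> (\<exists>j0<n. h j0 \<noteq> 0)"
    then show False
      using wh spos by simp
  qed
  then obtain j0 where j0: "j0 < n" "0 < h j0"
    by (auto simp: h_def)
  have gpos: "0 < g i" if "i < m" for i
  proof -
    have "0 < E i j0 * h j0"
      using E that j0 by simp
    also have "\<dots> \<le> mat_vec n E h i"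
      using that j0 E by (intro member_le_sum[of j0 "{..<n}" "\<lambda>j. E i j * h j"])
        (auto simp: h_def less_imp_le)
    finally show ?thesis
      using spos by (simp add: g_def)
  qed
  have "0 < h j" if "j < n" for j
  proof -
    have "0 < w j"
      unfolding w_def using that gpos E m by (intro sum_pos) auto
    then show ?thesis
      using hE[OF that] spos by (metis zero_less_mult_pos)
  qed
  then have "perron_pair m n E (g, h)"
    using gpos gE hE by (auto simp: perron_pair_def \<sigma>_def w_def)
  then show ?thesis by (rule that)
qed

subsection \<open>Detectors in a good observation scheme\<close>

locale good_scheme =
  fixes Ob :: "('w::polish_space, 'm::euclidean_space) obs_scheme"
  assumes good: "good_obs_scheme Ob"
begin

abbreviation "P \<equiv> ref_measure Ob"
abbreviation "p \<equiv> dens Ob"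
abbreviation "\<M> \<equiv> params Ob"

lemma sets_P [measurable_cong]: "sets P = sets borel"
  and sigma_finite_P: "sigma_finite_measure P"
  and convex_params: "convex \<M>"
  and integrable_dens: "\<mu> \<in> \<M> \<Longrightarrow> integrable P (p \<mu>)"
  and integral_dens: "\<mu> \<in> \<M> \<Longrightarrow> (\<integral>\<omega>. p \<mu> \<omega> \<partial>P) = 1"
  and dens_pos: "\<mu> \<in> \<M> \<Longrightarrow> 0 < p \<mu> \<omega>"
  and continuous_dens: "continuous_on (\<M> \<times> UNIV) (\<lambda>(\<mu>, \<omega>). p \<mu> \<omega>)"
  and integrable_exp: "\<phi> \<in> fspace Ob \<Longrightarrow> \<mu> \<in> \<M> \<Longrightarrow> integrable P (\<lambda>\<omega>. exp (\<phi> \<omega>) * p \<mu> \<omega>)"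
  and concave_Phi: "\<phi> \<in> fspace Ob \<Longrightarrow> concave_on \<M> (Phi Ob \<phi>)"
  using good by (auto simp: good_obs_scheme_def)

lemma measurable_dens: "\<mu> \<in> \<M> \<Longrightarrow> p \<mu> \<in> borel_measurable borel"
proof (rule borel_measurable_continuous_onI)
  assume \<mu>: "\<mu> \<in> \<M>"
  have "continuous_on UNIV (\<lambda>\<omega>. case (\<mu>, \<omega>) of (\<mu>, \<omega>) \<Rightarrow> p \<mu> \<omega>)"
    by (rule continuous_on_compose2[OF continuous_dens]) (use \<mu> in \<open>auto intro!: continuous_intros\<close>)
  then show "continuous_on UNIV (p \<mu>)"
    by simp
qed

lemma tendsto_dens:
  assumes "s \<longlonglongrightarrow> \<mu>" and "\<And>n. s n \<in> \<M>" and "\<mu> \<in> \<M>"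
  shows "(\<lambda>n. p (s n) \<omega>) \<longlonglongrightarrow> p \<mu> \<omega>"
proof -
  have "(\<lambda>n. case (s n, \<omega>) of (\<mu>, \<omega>) \<Rightarrow> p \<mu> \<omega>) \<longlonglongrightarrow> (case (\<mu>, \<omega>) of (\<mu>, \<omega>) \<Rightarrow> p \<mu> \<omega>)"
    by (rule continuous_on_tendsto_compose[OF continuous_dens])
      (use assms in \<open>auto intro!: tendsto_intros\<close>)
  then show ?thesis by simp
qed

text \<open>Detectors for arbitrary pairs of parameters: the saddle-point argument uses them along a
  whole segment of parameters, not just at the selected maximizers.\<close>

definition half :: "'m \<Rightarrow> 'm \<Rightarrow> 'w \<Rightarrow> real" where
  "half \<mu> \<nu> \<omega> = 1/2 * ln (p \<mu> \<omega> / p \<nu> \<omega>)"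

lemma half_in_fspace:
  assumes "\<mu> \<in> \<M>" "\<nu> \<in> \<M>"
  shows "half \<mu> \<nu> \<in> fspace Ob"
proof -
  have "fun_space.subspace (fspace Ob)" "(\<lambda>\<omega>. ln (p \<mu> \<omega> / p \<nu> \<omega>)) \<in> fspace Ob"
    using good assms by (auto simp: good_obs_scheme_def)
  then have "(\<lambda>\<omega>. 1/2 * ln (p \<mu> \<omega> / p \<nu> \<omega>)) \<in> fspace Ob"
    by (rule fun_space.subspace_scale)
  then show ?thesis by (simp add: half_def[abs_def])
qed

lemma half_swap: "\<mu> \<in> \<M> \<Longrightarrow> \<nu> \<in> \<M> \<Longrightarrow> half \<nu> \<mu> \<omega> = - half \<mu> \<nu> \<omega>"
  using dens_pos[of \<mu> \<omega>] dens_pos[of \<nu> \<omega>] by (simp add: half_def ln_div field_simps)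

lemma exp_half:
  assumes "\<mu> \<in> \<M>" "\<nu> \<in> \<M>"
  shows "exp (half \<mu> \<nu> \<omega>) = sqrt (p \<mu> \<omega> / p \<nu> \<omega>)"
proof -
  have "0 < p \<mu> \<omega> / p \<nu> \<omega>"
    using assms dens_pos by simp
  then have "half \<mu> \<nu> \<omega> = ln (sqrt (p \<mu> \<omega> / p \<nu> \<omega>))"
    unfolding half_def by (subst ln_sqrt) simp_all
  with \<open>0 < p \<mu> \<omega> / p \<nu> \<omega>\<close> show ?thesis
    by (simp only: exp_ln real_sqrt_gt_zero)
qed

lemma exp_half_mult:
  assumes "\<mu> \<in> \<M>" "\<nu> \<in> \<M>"
  shows "exp (half \<mu> \<nu> \<omega>) * p \<nu> \<omega> = sqrt (p \<mu> \<omega> * p \<nu> \<omega>)"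
proof -
  have "0 < p \<mu> \<omega>" "0 < p \<nu> \<omega>"
    using assms dens_pos by auto
  then show ?thesis
    using real_sqrt_mult_self[of "p \<nu> \<omega>"]
    by (simp add: exp_half[OF assms] real_sqrt_divide real_sqrt_mult field_simps)
qed

lemma measurable_half:
  assumes "\<mu> \<in> \<M>" "\<nu> \<in> \<M>"
  shows "half \<mu> \<nu> \<in> borel_measurable borel"
  using measurable_dens[OF assms(1)] measurable_dens[OF assms(2)]
  unfolding half_def[abs_def] by measurable

lemma affinity_commute: "affinity Ob \<mu> \<nu> = affinity Ob \<nu> \<mu>"
  by (simp add: affinity_def mult.commute)

lemma integrable_affinity:
  assumes "\<mu> \<in> \<M>" "\<nu> \<in> \<M>"
  shows "integrable P (\<lambda>\<omega>. sqrt (p \<mu> \<omega> * p \<nu> \<omega>))"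
  using assms by (intro integrable_sqrt_mult) (auto simp: integrable_dens less_imp_le[OF dens_pos])

lemma affinity_le_1:
  assumes "\<mu> \<in> \<M>" "\<nu> \<in> \<M>"
  shows "affinity Ob \<mu> \<nu> \<le> 1"
proof -
  have "(affinity Ob \<mu> \<nu>)\<^sup>2 \<le> (\<integral>\<omega>. p \<mu> \<omega> \<partial>P) * (\<integral>\<omega>. p \<nu> \<omega> \<partial>P)"
    unfolding affinity_def using assms
    by (intro integral_sqrt_mult_le) (auto simp: integrable_dens less_imp_le[OF dens_pos])
  then show ?thesis
    using assms by (simp add: integral_dens abs_square_le_1 abs_le_iff)
qed

text \<open>The parameter certifies that \<open>P\<close> is not null: a positive function with
  vanishing integral would force \<open>P\<close> to be null, and then no density could integrate to
  1.\<close>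

lemma integral_pos_params:
  fixes f :: "'w \<Rightarrow> real"
  assumes f: "integrable P f" "\<And>\<omega>. 0 < f \<omega>" and \<mu>: "\<mu> \<in> \<M>"
  shows "0 < integral\<^sup>L P f"
proof -
  have "integral\<^sup>L P f \<noteq> 0"
  proof
    assume "integral\<^sup>L P f = 0"
    then have "AE \<omega> in P. f \<omega> = 0"
      using f by (subst (asm) integral_nonneg_eq_0_iff_AE) (auto simp: less_imp_le)
    then have "AE \<omega> in P. p \<mu> \<omega> = 0"
      by eventually_elim (use f(2) in \<open>auto simp: less_le\<close>)
    then show False
      using integral_dens[OF \<mu>] integral_eq_zero_AE by fastforce
  qed
  moreover have "0 \<le> integral\<^sup>L P f"
    using f(2) by (intro Bochner_Integration.integral_nonneg) (auto simp: less_imp_le)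
  ultimately show ?thesis by simp
qed

lemma affinity_pos:
  assumes "\<mu> \<in> \<M>" "\<nu> \<in> \<M>"
  shows "0 < affinity Ob \<mu> \<nu>"
  unfolding affinity_def
  using assms dens_pos by (intro integral_pos_params[OF integrable_affinity]) auto

lemma exp_Phi:
  assumes "\<phi> \<in> fspace Ob" "\<mu> \<in> \<M>"
  shows "exp (Phi Ob \<phi> \<mu>) = (\<integral>\<omega>. exp (\<phi> \<omega>) * p \<mu> \<omega> \<partial>P)"
  unfolding Phi_def using assms dens_pos
  by (intro exp_ln integral_pos_params[OF integrable_exp]) auto

lemma Phi_half:
  assumes "\<mu> \<in> \<M>" "\<nu> \<in> \<M>"
  shows "Phi Ob (half \<mu> \<nu>) \<nu> = ln (affinity Ob \<mu> \<nu>)"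
  using assms by (simp add: Phi_def affinity_def exp_half_mult)

text \<open>Cauchy-Schwarz after the mutually inverse factors \<open>exp (half \<nu> \<mu>')\<close>
  and \<open>exp (half \<mu>' \<nu>)\<close> are inserted under the root. It is used as a lower
  bound on \<open>Phi\<close> for a detector built at \<open>\<mu>'\<close> and evaluated at another
  parameter \<open>\<mu>\<close>, in place of a derivative.\<close>

lemma affinity_sq_le:
  assumes "\<mu> \<in> \<M>" "\<nu> \<in> \<M>" "\<mu>' \<in> \<M>"
  shows "2 * ln (affinity Ob \<mu> \<nu>) \<le> Phi Ob (half \<nu> \<mu>') \<mu> + ln (affinity Ob \<mu>' \<nu>)"
proof -
  have h: "half \<nu> \<mu>' \<in> fspace Ob" "half \<mu>' \<nu> \<in> fspace Ob"
    using assms half_in_fspace by auto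
  have eq: "sqrt (p \<mu> \<omega> * p \<nu> \<omega>)
      = sqrt ((exp (half \<nu> \<mu>' \<omega>) * p \<mu> \<omega>) * (exp (half \<mu>' \<nu> \<omega>) * p \<nu> \<omega>))" for \<omega>
  proof -
    have "exp (half \<nu> \<mu>' \<omega>) * exp (half \<mu>' \<nu> \<omega>) = 1"
      using half_swap[OF assms(3,2), of \<omega>] by (simp flip: exp_add)
    then have "(exp (half \<nu> \<mu>' \<omega>) * p \<mu> \<omega>) * (exp (half \<mu>' \<nu> \<omega>) * p \<nu> \<omega>) = p \<mu> \<omega> * p \<nu> \<omega>"
      by (metis mult.assoc mult.commute mult_1)
    then show ?thesis by simp
  qed
  have "(affinity Ob \<mu> \<nu>)\<^sup>2
      = (\<integral>\<omega>. sqrt ((exp (half \<nu> \<mu>' \<omega>) * p \<mu> \<omega>) * (exp (half \<mu>' \<nu> \<omega>) * p \<nu> \<omega>)) \<partial>P)\<^sup>2"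
    by (simp only: affinity_def eq)
  also have "\<dots> \<le> (\<integral>\<omega>. exp (half \<nu> \<mu>' \<omega>) * p \<mu> \<omega> \<partial>P) * (\<integral>\<omega>. exp (half \<mu>' \<nu> \<omega>) * p \<nu> \<omega> \<partial>P)"
    using assms h by (intro integral_sqrt_mult_le integrable_exp) (auto simp: less_imp_le[OF dens_pos])
  also have "\<dots> = exp (Phi Ob (half \<nu> \<mu>') \<mu> + Phi Ob (half \<mu>' \<nu>) \<nu>)"
    using assms h by (simp add: exp_add exp_Phi)
  finally have "ln ((affinity Ob \<mu> \<nu>)\<^sup>2) \<le> ln (exp (Phi Ob (half \<nu> \<mu>') \<mu> + Phi Ob (half \<mu>' \<nu>) \<nu>))"
    using affinity_pos[OF assms(1,2)] by (intro ln_mono) auto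
  then show ?thesis
    using affinity_pos[OF assms(1,2)] Phi_half[OF assms(3,2)] by (simp add: ln_realpow)
qed

text \<open>If \<open>\<mu>\<^sub>0\<close> maximizes the affinity to \<open>\<nu>\<close> along the segment towards \<open>\<mu>\<close>, then concavity of
  \<open>Phi\<close> at the detector of \<open>(\<mu>\<^sub>t, \<nu>)\<close>, where \<open>\<mu>\<^sub>t = (1 - t) \<mu>\<^sub>0 + t \<mu>\<close>, bounds the moment of that
  detector under \<open>\<mu>\<close>; Fatou's lemma for \<open>t \<rightarrow> 0\<close> gives the bound for the detector of \<open>(\<mu>\<^sub>0, \<nu>)\<close>.\<close>

lemma moment_le_affinity:
  assumes \<mu>0: "\<mu>0 \<in> \<M>" and \<mu>: "\<mu> \<in> \<M>" and \<nu>: "\<nu> \<in> \<M>"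
    and max: "\<And>t. 0 \<le> t \<Longrightarrow> t \<le> 1 \<Longrightarrow> affinity Ob ((1 - t) *\<^sub>R \<mu>0 + t *\<^sub>R \<mu>) \<nu> \<le> affinity Ob \<mu>0 \<nu>"
  shows "integrable P (\<lambda>\<omega>. exp (half \<nu> \<mu>0 \<omega>) * p \<mu> \<omega>)"
    and "(\<integral>\<omega>. exp (half \<nu> \<mu>0 \<omega>) * p \<mu> \<omega> \<partial>P) \<le> affinity Ob \<mu>0 \<nu>"
proof -
  define m where "m t = (1 - t) *\<^sub>R \<mu>0 + t *\<^sub>R \<mu>" for t
  have m: "m t \<in> \<M>" if "0 \<le> t" "t \<le> 1" for t
    unfolding m_def using convex_params \<mu>0 \<mu> that by (auto simp: convex_alt)
  have bound: "(\<integral>\<omega>. exp (half \<nu> (m t) \<omega>) * p \<mu> \<omega> \<partial>P) \<le> affinity Ob \<mu>0 \<nu>" if t: "0 < t" "t \<le> 1" for t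
  proof -
    define G G0 F where "G = ln (affinity Ob (m t) \<nu>)" and "G0 = ln (affinity Ob \<mu>0 \<nu>)"
      and "F = Phi Ob (half \<nu> (m t))"
    have mt: "m t \<in> \<M>" using m t by simp
    \<comment> \<open>Concavity together with \<open>F (m t) = G\<close> and
      \<open>F \<mu>0 \<ge> 2 * G0 - G\<close> gives
      \<open>t * F \<mu> \<le> (2 - t) * G - 2 * (1 - t) * G0\<close>. As \<open>G \<le> G0\<close>,
      the right side is at most \<open>t * G0\<close>, and the factor \<open>t\<close>
      cancels.\<close>
    have "(1 - t) * F \<mu>0 + t * F \<mu> \<le> F (m t)"
      unfolding F_def m_def using t \<mu>0 \<mu> half_in_fspace[OF \<nu> mt]
      by (intro concave_onD[OF concave_Phi]) (auto simp: m_def)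
    moreover have "F (m t) = G"
      using Phi_half[OF \<nu> mt] by (simp add: F_def G_def affinity_commute)
    moreover have "(1 - t) * (2 * G0 - G) \<le> (1 - t) * F \<mu>0"
      using affinity_sq_le[OF \<mu>0 \<nu> mt] t by (intro mult_left_mono) (auto simp: F_def G_def G0_def)
    moreover have "G \<le> G0"
      using max[of t] t affinity_pos[OF mt \<nu>] by (simp add: G_def G0_def m_def)
    ultimately have "t * F \<mu> \<le> G - (1 - t) * (2 * G0 - G)" "(2 - t) * G \<le> (2 - t) * G0"
      using t by (auto intro!: mult_left_mono)
    then have "t * F \<mu> \<le> t * G0"
      by (simp add: algebra_simps)
    then have "F \<mu> \<le> G0"
      using t by simp
    then have "exp (F \<mu>) \<le> exp G0" by simp
    then show ?thesis
      using affinity_pos[OF \<mu>0 \<nu>] exp_Phi[OF half_in_fspace[OF \<nu> mt] \<mu>] by (simp add: F_def G0_def)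
  qed
  define s where "s n = inverse (real (Suc n))" for n
  have s: "0 < s n" "s n \<le> 1" for n
    by (auto simp: s_def inverse_le_1_iff)
  have s0: "s \<longlonglongrightarrow> 0"
    unfolding s_def[abs_def] by (rule LIMSEQ_inverse_real_of_nat)
  have "(\<lambda>n. m (s n)) \<longlonglongrightarrow> (1 - 0) *\<^sub>R \<mu>0 + 0 *\<^sub>R \<mu>"
    unfolding m_def by (intro tendsto_intros s0)
  then have ml: "(\<lambda>n. m (s n)) \<longlonglongrightarrow> \<mu>0" by simp
  have ms: "m (s n) \<in> \<M>" for n
    using m s[of n] by simp
  have lim: "(\<lambda>n. exp (half \<nu> (m (s n)) \<omega>) * p \<mu> \<omega>) \<longlonglongrightarrow> exp (half \<nu> \<mu>0 \<omega>) * p \<mu> \<omega>" for \<omega>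
    unfolding exp_half[OF \<nu> ms] exp_half[OF \<nu> \<mu>0]
    using dens_pos[OF \<mu>0, of \<omega>]
    by (intro tendsto_intros tendsto_dens[OF ml ms \<mu>0]) auto
  note F = Fatou_real[where f="\<lambda>n \<omega>. exp (half \<nu> (m (s n)) \<omega>) * p \<mu> \<omega>"
      and g="\<lambda>\<omega>. exp (half \<nu> \<mu>0 \<omega>) * p \<mu> \<omega>" and c="\<lambda>_. affinity Ob \<mu>0 \<nu>" and M=P,
      OF integrable_exp[OF half_in_fspace[OF \<nu> ms] \<mu>] _ lim bound[OF s] tendsto_const]
  show "integrable P (\<lambda>\<omega>. exp (half \<nu> \<mu>0 \<omega>) * p \<mu> \<omega>)"
    and "(\<integral>\<omega>. exp (half \<nu> \<mu>0 \<omega>) * p \<mu> \<omega> \<partial>P) \<le> affinity Ob \<mu>0 \<nu>"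
    using F dens_pos[OF \<mu>] by (auto simp: less_imp_le)
qed

text \<open>A valid selection is constrained only where a maximizer exists, so existence has to be
  proved. A maximizing sequence in the compact product has a convergent subsequence, and upper
  semicontinuity of the affinity at its limit suffices.\<close>

lemma affinity_attains_max:
  assumes S: "compact S" "S \<noteq> {}" "S \<subseteq> \<M>" and T: "compact T" "T \<noteq> {}" "T \<subseteq> \<M>"
  shows "\<exists>r\<in>S. \<exists>s\<in>T. \<forall>r'\<in>S. \<forall>s'\<in>T. affinity Ob r' s' \<le> affinity Ob r s"
proof -
  define a where "a z = affinity Ob (fst z) (snd z)" for z
  have bdd: "bdd_above (a ` (S \<times> T))"
    by (intro bdd_aboveI2[where M=1]) (use S T in \<open>auto simp: a_def intro!: affinity_le_1\<close>)
  define C where "C = (SUP z\<in>S \<times> T. a z)"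
  have "\<exists>z\<in>S \<times> T. C - inverse (real (Suc n)) < a z" for n
    using less_cSUP_iff[of "S \<times> T" a "C - inverse (real (Suc n))"] bdd S T by (auto simp: C_def)
  then obtain z where z: "\<And>n. z n \<in> S \<times> T" "\<And>n. C - inverse (real (Suc n)) < a (z n)"
    by metis
  have "compact (S \<times> T)"
    using S T by (intro compact_Times)
  then obtain l q where l: "l \<in> S \<times> T" and q: "strict_mono q" and lim: "(z \<circ> q) \<longlonglongrightarrow> l"
    using z(1) unfolding compact_def by metis
  define r s where "r = fst l" and "s = snd l"
  have rs: "r \<in> S" "s \<in> T" "r \<in> \<M>" "s \<in> \<M>"
    using l S T by (auto simp: r_def s_def mem_Times_iff)
  have zM: "fst (z n) \<in> \<M>" "snd (z n) \<in> \<M>" for n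
    using z(1)[of n] S T by (auto simp: mem_Times_iff)
  have limr: "(\<lambda>n. fst (z (q n))) \<longlonglongrightarrow> r" and lims: "(\<lambda>n. snd (z (q n))) \<longlonglongrightarrow> s"
    using tendsto_fst[OF lim] tendsto_snd[OF lim] by (auto simp: r_def s_def o_def)
  \<comment> \<open>\<open>1 - affinity\<close> is the integral of a nonnegative function, so Fatou's lemma makes the affinity
    upper semicontinuous.\<close>
  define d where "d \<mu> \<nu> \<omega> = (p \<mu> \<omega> + p \<nu> \<omega>) / 2 - sqrt (p \<mu> \<omega> * p \<nu> \<omega>)" for \<mu> \<nu> \<omega>
  have d0: "0 \<le> d \<mu> \<nu> \<omega>" if "\<mu> \<in> \<M>" "\<nu> \<in> \<M>" for \<mu> \<nu> \<omega>
    using arith_geo_mean_sqrt[of "p \<mu> \<omega>" "p \<nu> \<omega>"] that dens_pos by (auto simp: d_def less_imp_le)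
  have dint: "integrable P (d \<mu> \<nu>)" and dI: "integral\<^sup>L P (d \<mu> \<nu>) = 1 - affinity Ob \<mu> \<nu>"
    if "\<mu> \<in> \<M>" "\<nu> \<in> \<M>" for \<mu> \<nu>
    unfolding d_def[abs_def] affinity_def
    using that integrable_dens integral_dens integrable_affinity by auto
  have "integral\<^sup>L P (d r s) \<le> 1 - C"
  proof (rule Fatou_real(2))
    show "(\<lambda>n. d (fst (z (q n))) (snd (z (q n))) \<omega>) \<longlonglongrightarrow> d r s \<omega>" for \<omega>
      unfolding d_def by (intro tendsto_intros tendsto_dens[OF limr] tendsto_dens[OF lims] zM rs) auto
    show "integral\<^sup>L P (d (fst (z (q n))) (snd (z (q n)))) \<le> 1 - (C - inverse (real (Suc (q n))))" for n
      using z(2)[of "q n"] dI[OF zM, of "q n" "q n"] by (simp add: a_def)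
    have "(\<lambda>n. inverse (real (Suc (q n)))) \<longlonglongrightarrow> 0"
      using LIMSEQ_subseq_LIMSEQ[OF LIMSEQ_inverse_real_of_nat q] by (simp add: o_def)
    then have "(\<lambda>n. 1 - (C - inverse (real (Suc (q n))))) \<longlonglongrightarrow> 1 - (C - 0)"
      by (intro tendsto_intros)
    then show "(\<lambda>n. 1 - (C - inverse (real (Suc (q n))))) \<longlonglongrightarrow> 1 - C"
      by simp
  qed (use dint d0 zM in auto)
  then have "C \<le> affinity Ob r s"
    using dI rs by simp
  moreover have "affinity Ob r' s' \<le> C" if "r' \<in> S" "s' \<in> T" for r' s'
    using cSUP_upper[OF _ bdd, of "(r', s')"] that by (auto simp: C_def a_def)
  ultimately show ?thesis
    using rs by (meson order_trans)
qed

end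

subsection \<open>The selected pairs of points\<close>

abbreviation obs_space :: "nat \<Rightarrow> (nat \<Rightarrow> 'w::polish_space) measure" where
  "obs_space K \<equiv> PiM {1..K} (\<lambda>_. borel)"

section \<open>Sample laws and the Chernoff bound\<close>

context good_scheme
begin

abbreviation "law \<mu> \<equiv> density P (\<lambda>\<omega>. ennreal (p \<mu> \<omega>))"

lemma prob_space_law: "\<mu> \<in> \<M> \<Longrightarrow> prob_space (law \<mu>)"
proof
  assume \<mu>: "\<mu> \<in> \<M>"
  have [measurable]: "p \<mu> \<in> borel_measurable P"
    using integrable_dens[OF \<mu>] by auto
  have "(\<integral>\<^sup>+\<omega>. ennreal (p \<mu> \<omega>) \<partial>P) = 1"
    using \<mu> dens_pos by (subst nn_integral_eq_integral) (auto simp: integrable_dens integral_dens less_imp_le)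
  then show "emeasure (law \<mu>) (space (law \<mu>)) = 1"
    by (simp add: emeasure_density cong: nn_integral_cong)
qed

lemma sets_sample_law: "sets (sample_law Ob K \<mu>) = sets (obs_space K)"
  unfolding sample_law_def by (intro sets_PiM_cong) (auto simp: sets_P)

lemma space_sample_law: "space (sample_law Ob K \<mu>) = space (obs_space K)"
  by (rule sets_eq_imp_space_eq) (rule sets_sample_law)

lemma prob_space_sample_law: "\<mu> \<in> \<M> \<Longrightarrow> prob_space (sample_law Ob K \<mu>)"
  unfolding sample_law_def by (intro prob_space_PiM prob_space_law)

lemma product_law: "\<mu> \<in> \<M> \<Longrightarrow> product_sigma_finite (\<lambda>_. law \<mu>)"
  by (simp add: product_sigma_finite_def prob_space_law prob_space_imp_sigma_finite)

lemma product_P: "product_sigma_finite (\<lambda>_. P)"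
  by (simp add: product_sigma_finite_def sigma_finite_P)

text \<open>Markov's inequality for the exponential of the sum, whose expectation is a product of
  one-observation moments by independence. It is applied to plus and minus a detector; the factor
  \<open>exp (- c)\<close> will become a ratio of Perron-Frobenius weights.\<close>

lemma Chernoff_sample_law:
  assumes \<mu>: "\<mu> \<in> \<M>" and \<phi>[measurable]: "\<phi> \<in> borel_measurable borel"
    and int: "integrable P (\<lambda>\<omega>. exp (\<phi> \<omega>) * p \<mu> \<omega>)"
    and e: "(\<integral>\<omega>. exp (\<phi> \<omega>) * p \<mu> \<omega> \<partial>P) \<le> e"
  shows "measure (sample_law Ob K \<mu>) {\<omega>\<in>space (obs_space K). c \<le> (\<Sum>t=1..K. \<phi> (\<omega> t))}
    \<le> e ^ K * exp (- c)"
proof -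
  let ?S = "sample_law Ob K \<mu>"
  interpret prob_space ?S by (rule prob_space_sample_law[OF \<mu>])
  interpret L: product_sigma_finite "\<lambda>_::nat. law \<mu>" by (rule product_law[OF \<mu>])
  have [measurable]: "p \<mu> \<in> borel_measurable P"
    using integrable_dens[OF \<mu>] by auto
  have e0: "0 \<le> e"
    using e by (rule order_trans[rotated])
      (use dens_pos[OF \<mu>] in \<open>auto intro!: Bochner_Integration.integral_nonneg simp: less_imp_le\<close>)
  have \<phi>': "\<phi> \<in> borel_measurable (law \<mu>)"
    using \<phi> by (simp add: sets_P measurable_cong_sets[OF _ refl, of "law \<mu>" borel])
  have one: "(\<integral>\<^sup>+\<omega>. ennreal (exp (\<phi> \<omega>)) \<partial>law \<mu>) \<le> ennreal e"
  proof -
    have "(\<integral>\<^sup>+\<omega>. ennreal (exp (\<phi> \<omega>)) \<partial>law \<mu>) = (\<integral>\<^sup>+\<omega>. ennreal (exp (\<phi> \<omega>) * p \<mu> \<omega>) \<partial>P)"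
      using dens_pos[OF \<mu>]
      by (subst nn_integral_density) (auto simp: ennreal_mult'' less_imp_le mult.commute)
    also have "\<dots> = ennreal (\<integral>\<omega>. exp (\<phi> \<omega>) * p \<mu> \<omega> \<partial>P)"
      using int dens_pos[OF \<mu>] by (intro nn_integral_eq_integral) (auto simp: less_imp_le)
    finally show ?thesis
      using e by (simp add: ennreal_leI)
  qed
  define u where "u \<omega> = (\<Prod>t\<in>{1..K}. ennreal (exp (\<phi> (\<omega> t))))" for \<omega> :: "nat \<Rightarrow> 'w"
  have u: "u \<omega> = ennreal (exp (\<Sum>t=1..K. \<phi> (\<omega> t)))" for \<omega>
    by (simp add: u_def exp_sum prod_ennreal)
  have "u \<in> borel_measurable (obs_space K)"
    unfolding u_def[abs_def] by measurable
  then have um[measurable]: "u \<in> borel_measurable ?S"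
    by (simp add: measurable_cong_sets[OF sets_sample_law refl])
  have "emeasure ?S {\<omega>\<in>space (obs_space K). c \<le> (\<Sum>t=1..K. \<phi> (\<omega> t))}
      = emeasure ?S {\<omega>\<in>space ?S. 1 \<le> ennreal (exp (- c)) * u \<omega>}"
    unfolding space_sample_law
    by (intro arg_cong2[where f=emeasure] refl Collect_cong)
      (simp add: u flip: ennreal_mult' exp_add)
  also have "\<dots> \<le> ennreal (exp (- c)) * (\<integral>\<^sup>+\<omega>. u \<omega> * indicator (space ?S) \<omega> \<partial>?S)"
    by (intro nn_integral_Markov_inequality) simp_all
  also have "(\<integral>\<^sup>+\<omega>. u \<omega> * indicator (space ?S) \<omega> \<partial>?S) = (\<integral>\<^sup>+\<omega>. u \<omega> \<partial>?S)"
    by (intro nn_integral_cong) simp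
  also have "\<dots> = (\<Prod>t\<in>{1..K}. \<integral>\<^sup>+\<omega>. ennreal (exp (\<phi> \<omega>)) \<partial>law \<mu>)"
    unfolding u_def sample_law_def using \<phi>' by (intro L.product_nn_integral_prod) auto
  also have "ennreal (exp (- c)) * \<dots> \<le> ennreal (exp (- c)) * (\<Prod>t\<in>{1..K}. ennreal e)"
    using one by (intro mult_left_mono prod_mono_ennreal) auto
  also have "\<dots> = ennreal (e ^ K * exp (- c))"
    using e0 by (simp add: ennreal_power ennreal_mult mult.commute)
  finally show ?thesis
    using e0 by (simp add: emeasure_eq_measure)
qed

end

section \<open>Convex pieces of the level sets and their maximizing pairs\<close>

lemma length_concat_map_le:
  assumes "\<And>x. x \<in> set xs \<Longrightarrow> length (g x) \<le> k"
  shows "length (concat (map g xs)) \<le> length xs * k"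
  using assms by (induction xs) (auto simp: add_mono)

locale bisection = good_scheme Ob
  for Ob :: "('w::polish_space, 'm::euclidean_space) obs_scheme" +
  fixes XX :: "'n::euclidean_space set"
    and I :: nat and X :: "nat \<Rightarrow> 'n set"
    and A :: "'n \<Rightarrow> 'm" and f :: "'n \<Rightarrow> real"
    and N :: nat and Xge Xle :: "real \<Rightarrow> nat \<Rightarrow> 'n set"
    and rs :: "real \<Rightarrow> real \<Rightarrow> nat \<Rightarrow> nat \<Rightarrow> 'n \<times> 'n"
    and pr :: "('w, 'm, 'n) problem"
  assumes pr: "pr = \<lparr> scheme = Ob, encode = A, num = I, part = X, ncvx = N,
                 ge_rep = Xge, le_rep = Xle, sel = rs \<rparr>"
    and X: "\<forall>i\<in>{1..I}. convex (X i) \<and> compact (X i) \<and> X i \<subseteq> XX"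
    and affine: "affine_map_on XX A" and A_params: "A ` XX \<subseteq> params Ob"
    and rep: "N_convex_rep XX f N Xge Xle"
    and sel: "valid_selection pr"
begin

lemma pr_simps [simp]:
  "scheme pr = Ob" "encode pr = A" "num pr = I" "part pr = X" "ncvx pr = N"
  "ge_rep pr = Xge" "le_rep pr = Xle" "problem.sel pr = rs"
  by (simp_all add: pr)

lemma signal_subset: "signal_set pr \<subseteq> XX"
  using X by (auto simp: signal_set_def)

lemma signal_params: "x \<in> signal_set pr \<Longrightarrow> A x \<in> \<M>"
  using signal_subset A_params by auto

lemma upper_sets_iff:
  "Z \<in> set (upper_sets pr b) \<longleftrightarrow> Z \<noteq> {} \<and> (\<exists>i\<in>{1..I}. \<exists>\<nu>\<in>{1..N}. Z = X i \<inter> Xge b \<nu>)"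
  by (simp only: upper_sets_def pr_simps set_filter set_concat set_map set_upt
      atLeastLessThanSuc_atLeastAtMost image_image) blast

lemma lower_sets_iff:
  "Z \<in> set (lower_sets pr a) \<longleftrightarrow> Z \<noteq> {} \<and> (\<exists>i\<in>{1..I}. \<exists>\<nu>\<in>{1..N}. Z = X i \<inter> Xle a \<nu>)"
  by (simp only: lower_sets_def pr_simps set_filter set_concat set_map set_upt
      atLeastLessThanSuc_atLeastAtMost image_image) blast

lemma length_upper_sets: "length (upper_sets pr b) \<le> I * N"
proof -
  have "length (concat (map (\<lambda>i. map (\<lambda>\<nu>. X i \<inter> Xge b \<nu>) [1..<Suc N]) [1..<Suc I])) \<le> length [1..<Suc I] * N"
    by (rule length_concat_map_le) simp
  then show ?thesis
    unfolding upper_sets_def pr_simps by (intro order_trans[OF length_filter_le]) (simp del: upt_Suc)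
qed

lemma length_lower_sets: "length (lower_sets pr b) \<le> I * N"
proof -
  have "length (concat (map (\<lambda>i. map (\<lambda>\<nu>. X i \<inter> Xle b \<nu>) [1..<Suc N]) [1..<Suc I])) \<le> length [1..<Suc I] * N"
    by (rule length_concat_map_le) simp
  then show ?thesis
    unfolding lower_sets_def pr_simps by (intro order_trans[OF length_filter_le]) (simp del: upt_Suc)
qed

lemma level_sets:
  "{x\<in>XX. f x \<ge> a} = (\<Union>\<nu>\<in>{1..N}. Xge a \<nu>)"
  "{x\<in>XX. f x \<le> a} = (\<Union>\<nu>\<in>{1..N}. Xle a \<nu>)"
  using rep unfolding N_convex_rep_def by blast+

lemma upper_set:
  assumes "i < length (upper_sets pr b)"
  shows "upper_sets pr b ! i \<noteq> {}" "compact (upper_sets pr b ! i)" "convex (upper_sets pr b ! i)"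
    "upper_sets pr b ! i \<subseteq> {x \<in> signal_set pr. b \<le> f x}"
proof -
  obtain k \<nu> where *: "k \<in> {1..I}" "\<nu> \<in> {1..N}" "upper_sets pr b ! i = X k \<inter> Xge b \<nu>"
    and ne: "upper_sets pr b ! i \<noteq> {}"
    using nth_mem[OF assms] unfolding upper_sets_iff by blast
  have r: "closed (Xge b \<nu>)" "convex (Xge b \<nu>)"
    using rep *(2) by (auto simp: N_convex_rep_def)
  show "upper_sets pr b ! i \<noteq> {}" "compact (upper_sets pr b ! i)" "convex (upper_sets pr b ! i)"
    using ne * r X by (auto intro: compact_Int_closed convex_Int)
  show "upper_sets pr b ! i \<subseteq> {x \<in> signal_set pr. b \<le> f x}"
    using *(1,2) level_sets(1)[of b] X unfolding *(3) by (auto simp: signal_set_def)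
qed

lemma lower_set:
  assumes "i < length (lower_sets pr a)"
  shows "lower_sets pr a ! i \<noteq> {}" "compact (lower_sets pr a ! i)" "convex (lower_sets pr a ! i)"
    "lower_sets pr a ! i \<subseteq> {x \<in> signal_set pr. f x \<le> a}"
proof -
  obtain k \<nu> where *: "k \<in> {1..I}" "\<nu> \<in> {1..N}" "lower_sets pr a ! i = X k \<inter> Xle a \<nu>"
    and ne: "lower_sets pr a ! i \<noteq> {}"
    using nth_mem[OF assms] unfolding lower_sets_iff by blast
  have r: "closed (Xle a \<nu>)" "convex (Xle a \<nu>)"
    using rep *(2) by (auto simp: N_convex_rep_def)
  show "lower_sets pr a ! i \<noteq> {}" "compact (lower_sets pr a ! i)" "convex (lower_sets pr a ! i)"
    using ne * r X by (auto intro: compact_Int_closed convex_Int)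
  show "lower_sets pr a ! i \<subseteq> {x \<in> signal_set pr. f x \<le> a}"
    using *(1,2) level_sets(2)[of a] X unfolding *(3) by (auto simp: signal_set_def)
qed

lemma upper_set_cover:
  assumes "x \<in> signal_set pr" "b \<le> f x"
  obtains i where "i < length (upper_sets pr b)" "x \<in> upper_sets pr b ! i"
proof -
  obtain k where k: "k \<in> {1..I}" "x \<in> X k"
    using assms by (auto simp: signal_set_def)
  have "x \<in> (\<Union>\<nu>\<in>{1..N}. Xge b \<nu>)"
    using assms signal_subset unfolding level_sets[symmetric] by auto
  then obtain \<nu> where "\<nu> \<in> {1..N}" "x \<in> Xge b \<nu>" by blast
  with k have "X k \<inter> Xge b \<nu> \<in> set (upper_sets pr b)" "x \<in> X k \<inter> Xge b \<nu>"
    by (auto simp: upper_sets_iff simp del: atLeastAtMost_iff)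
  then show ?thesis
    using that by (metis in_set_conv_nth)
qed

lemma lower_set_cover:
  assumes "x \<in> signal_set pr" "f x \<le> a"
  obtains i where "i < length (lower_sets pr a)" "x \<in> lower_sets pr a ! i"
proof -
  obtain k where k: "k \<in> {1..I}" "x \<in> X k"
    using assms by (auto simp: signal_set_def)
  have "x \<in> (\<Union>\<nu>\<in>{1..N}. Xle a \<nu>)"
    using assms signal_subset unfolding level_sets[symmetric] by auto
  then obtain \<nu> where "\<nu> \<in> {1..N}" "x \<in> Xle a \<nu>" by blast
  with k have "X k \<inter> Xle a \<nu> \<in> set (lower_sets pr a)" "x \<in> X k \<inter> Xle a \<nu>"
    by (auto simp: lower_sets_iff simp del: atLeastAtMost_iff)
  then show ?thesis
    using that by (metis in_set_conv_nth)
qed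

lemma upper_feasibleI: "x \<in> signal_set pr \<Longrightarrow> b \<le> f x \<Longrightarrow> upper_feasible pr b"
  unfolding upper_feasible_def by (rule upper_set_cover[of x b]) auto

lemma lower_feasibleI: "x \<in> signal_set pr \<Longrightarrow> f x \<le> a \<Longrightarrow> lower_feasible pr a"
  unfolding lower_feasible_def by (rule lower_set_cover[of x a]) auto

lemma affine_convex_comb:
  assumes "x \<in> XX" "y \<in> XX" "(1 - t) *\<^sub>R x + t *\<^sub>R y \<in> XX"
  shows "A ((1 - t) *\<^sub>R x + t *\<^sub>R y) = (1 - t) *\<^sub>R A x + t *\<^sub>R A y"
proof -
  obtain T c where T: "linear T" "\<And>x. x \<in> XX \<Longrightarrow> A x = T x + c"
    using affine by (auto simp: affine_map_on_def)
  show ?thesis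
    using assms by (simp add: T linear_add linear_scale scaleR_add_right)
qed

lemma continuous_on_A: "continuous_on XX A"
proof -
  obtain T c where T: "linear T" "\<And>x. x \<in> XX \<Longrightarrow> A x = T x + c"
    using affine by (auto simp: affine_map_on_def)
  have "continuous_on XX (\<lambda>x. T x + c)"
    using T(1) by (intro continuous_intros linear_continuous_on) (simp add: linear_conv_bounded_linear)
  then show ?thesis
    using T(2) by (simp cong: continuous_on_cong)
qed

abbreviation "pt_r a b i j \<equiv> fst (rs a b i j)"
abbreviation "pt_s a b i j \<equiv> snd (rs a b i j)"

text \<open>Attainment of the maximal affinity discharges the existence premise in
  \<open>valid_selection\<close>; positivity of affinities then removes the logarithm from the
  maximized function.\<close>

lemma selection:
  assumes ab: "a < b" and i: "i < length (upper_sets pr b)" and j: "j < length (lower_sets pr a)"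
  shows "pt_r a b i j \<in> upper_sets pr b ! i" "pt_s a b i j \<in> lower_sets pr a ! j"
    "\<And>r s. r \<in> upper_sets pr b ! i \<Longrightarrow> s \<in> lower_sets pr a ! j \<Longrightarrow>
      affinity Ob (A r) (A s) \<le> affinity Ob (A (pt_r a b i j)) (A (pt_s a b i j))"
proof -
  let ?Z = "upper_sets pr b ! i" and ?Z' = "lower_sets pr a ! j"
  note U = upper_set[OF i] and L = lower_set[OF j]
  have sub: "?Z \<subseteq> XX" "?Z' \<subseteq> XX"
    using U(4) L(4) signal_subset by auto
  have img: "A ` ?Z \<subseteq> \<M>" "A ` ?Z' \<subseteq> \<M>"
    using sub A_params by blast+
  have pos: "0 < affinity Ob (A r) (A s)" if "r \<in> ?Z" "s \<in> ?Z'" for r s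
    using that sub A_params by (intro affinity_pos) auto
  have "\<exists>r\<in>A ` ?Z. \<exists>s\<in>A ` ?Z'. \<forall>r'\<in>A ` ?Z. \<forall>s'\<in>A ` ?Z'. affinity Ob r' s' \<le> affinity Ob r s"
    using U(1,2) L(1,2) sub img
    by (intro affinity_attains_max compact_continuous_image continuous_on_subset[OF continuous_on_A]) auto
  then obtain r s where rs: "r \<in> ?Z" "s \<in> ?Z'"
    and max: "\<And>r' s'. r' \<in> ?Z \<Longrightarrow> s' \<in> ?Z' \<Longrightarrow> affinity Ob (A r') (A s') \<le> affinity Ob (A r) (A s)"
    by blast
  have "maximizer pr ?Z ?Z' (r, s)"
    unfolding maximizer_def is_arg_max_linorder using rs max pos by (auto simp: not_le)
  then have "maximizer pr ?Z ?Z' (rs a b i j)"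
    using sel ab i j unfolding valid_selection_def pr_simps by blast
  then have m: "pt_r a b i j \<in> ?Z \<and> pt_s a b i j \<in> ?Z'"
    "\<And>r s. r \<in> ?Z \<Longrightarrow> s \<in> ?Z' \<Longrightarrow>
      ln (affinity Ob (A r) (A s)) \<le> ln (affinity Ob (A (pt_r a b i j)) (A (pt_s a b i j)))"
    unfolding maximizer_def is_arg_max_linorder by (auto simp: case_prod_beta)
  then show "pt_r a b i j \<in> ?Z" "pt_s a b i j \<in> ?Z'"
    by auto
  show "affinity Ob (A r) (A s) \<le> affinity Ob (A (pt_r a b i j)) (A (pt_s a b i j))"
    if "r \<in> ?Z" "s \<in> ?Z'" for r s
    using m(2)[OF that] pos that m(1) by simp
qed

lemma selection_params:
  assumes "a < b" and "i < length (upper_sets pr b)" and "j < length (lower_sets pr a)"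
  shows "A (pt_r a b i j) \<in> \<M>" "A (pt_s a b i j) \<in> \<M>"
  using selection(1,2)[OF assms] upper_set(4)[OF assms(2)] lower_set(4)[OF assms(3)] signal_params by auto

lemma pair_risk_eq: "pair_risk pr a b i j = affinity Ob (A (pt_r a b i j)) (A (pt_s a b i j))"
  by (simp add: pair_risk_def case_prod_beta)

lemma detector_eq: "detector pr a b i j = half (A (pt_r a b i j)) (A (pt_s a b i j))"
  by (simp add: fun_eq_iff detector_def half_def case_prod_beta)

lemma measurable_detector:
  assumes "a < b" and "i < length (upper_sets pr b)" and "j < length (lower_sets pr a)"
  shows "detector pr a b i j \<in> borel_measurable borel"
  unfolding detector_eq using selection_params[OF assms] by (intro measurable_half)

lemma pair_risk_pos:
  assumes "a < b" and "i < length (upper_sets pr b)" and "j < length (lower_sets pr a)"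
  shows "0 < pair_risk pr a b i j"
  unfolding pair_risk_eq using selection_params[OF assms] by (intro affinity_pos)

text \<open>Moving only the first selected point towards \<open>x\<close> stays in the convex piece,
  and \<open>A\<close> maps this segment to a segment of parameters. Maximality of the selected pair
  along it is the hypothesis of \<open>moment_le_affinity\<close>; the lower version moves the
  second point.\<close>

lemma detector_moment_upper:
  assumes ab: "a < b" and i: "i < length (upper_sets pr b)" and j: "j < length (lower_sets pr a)"
    and x: "x \<in> upper_sets pr b ! i"
  shows "integrable P (\<lambda>\<omega>. exp (- detector pr a b i j \<omega>) * p (A x) \<omega>)"
    and "(\<integral>\<omega>. exp (- detector pr a b i j \<omega>) * p (A x) \<omega> \<partial>P) \<le> pair_risk pr a b i j"
proof -
  let ?r = "pt_r a b i j" and ?s = "pt_s a b i j"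
  note S = selection[OF ab i j] and M = selection_params[OF ab i j]
  note U = upper_set(3,4)[OF i]
  have "affinity Ob ((1 - t) *\<^sub>R A ?r + t *\<^sub>R A x) (A ?s) \<le> affinity Ob (A ?r) (A ?s)"
    if "0 \<le> t" "t \<le> 1" for t
  proof -
    have "(1 - t) *\<^sub>R ?r + t *\<^sub>R x \<in> upper_sets pr b ! i"
      using U(1) S(1) x that by (auto simp: convex_alt)
    moreover from this have "A ((1 - t) *\<^sub>R ?r + t *\<^sub>R x) = (1 - t) *\<^sub>R A ?r + t *\<^sub>R A x"
      using U(2) signal_subset S(1) x by (intro affine_convex_comb) auto
    ultimately show ?thesis
      using S(3)[of "(1 - t) *\<^sub>R ?r + t *\<^sub>R x" ?s] S(2) by simp
  qed
  moreover have "A x \<in> \<M>"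
    using U(2) x signal_params by auto
  ultimately show "integrable P (\<lambda>\<omega>. exp (- detector pr a b i j \<omega>) * p (A x) \<omega>)"
    and "(\<integral>\<omega>. exp (- detector pr a b i j \<omega>) * p (A x) \<omega> \<partial>P) \<le> pair_risk pr a b i j"
    using moment_le_affinity[OF M(1) _ M(2), of "A x"] half_swap[OF M]
    by (simp_all add: detector_eq pair_risk_eq)
qed

lemma detector_moment_lower:
  assumes ab: "a < b" and i: "i < length (upper_sets pr b)" and j: "j < length (lower_sets pr a)"
    and x: "x \<in> lower_sets pr a ! j"
  shows "integrable P (\<lambda>\<omega>. exp (detector pr a b i j \<omega>) * p (A x) \<omega>)"
    and "(\<integral>\<omega>. exp (detector pr a b i j \<omega>) * p (A x) \<omega> \<partial>P) \<le> pair_risk pr a b i j"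
proof -
  let ?r = "pt_r a b i j" and ?s = "pt_s a b i j"
  note S = selection[OF ab i j] and M = selection_params[OF ab i j]
  note L = lower_set(3,4)[OF j]
  have "affinity Ob ((1 - t) *\<^sub>R A ?s + t *\<^sub>R A x) (A ?r) \<le> affinity Ob (A ?s) (A ?r)"
    if "0 \<le> t" "t \<le> 1" for t
  proof -
    have "(1 - t) *\<^sub>R ?s + t *\<^sub>R x \<in> lower_sets pr a ! j"
      using L(1) S(2) x that by (auto simp: convex_alt)
    moreover from this have "A ((1 - t) *\<^sub>R ?s + t *\<^sub>R x) = (1 - t) *\<^sub>R A ?s + t *\<^sub>R A x"
      using L(2) signal_subset S(2) x by (intro affine_convex_comb) auto
    ultimately show ?thesis
      using S(3)[of ?r "(1 - t) *\<^sub>R ?s + t *\<^sub>R x"] S(1) by (simp add: affinity_commute)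
  qed
  moreover have "A x \<in> \<M>"
    using L(2) x signal_params by auto
  ultimately show "integrable P (\<lambda>\<omega>. exp (detector pr a b i j \<omega>) * p (A x) \<omega>)"
    and "(\<integral>\<omega>. exp (detector pr a b i j \<omega>) * p (A x) \<omega> \<partial>P) \<le> pair_risk pr a b i j"
    using moment_le_affinity[OF M(2) _ M(1), of "A x"]
    by (simp_all add: detector_eq pair_risk_eq affinity_commute)
qed

end

subsection \<open>Reliability of the tests and of Bisection\<close>

lemma right_end:
  assumes "\<kappa> > 0" and good: "good_right pr K \<delta> c b"
  defines "v \<equiv> right_end pr K \<delta> \<kappa> c b"
  shows "c < v" "v \<le> b" "good_right pr K \<delta> c v" "\<not> good_right pr K \<delta> c (v - \<kappa>)"
proof -
  define Q where "Q k \<longleftrightarrow> \<not> good_right pr K \<delta> c (b - real k * \<kappa>)" for k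
  \<comment> \<open>Some candidate fails: far enough along the grid it has passed \<open>c\<close>,
    and good segments have positive length.\<close>
  obtain k where "(b - c) / \<kappa> < real k"
    using reals_Archimedean2 by blast
  then have "Q k"
    using \<open>\<kappa> > 0\<close> by (simp add: Q_def good_right_def field_simps)
  then have Q: "Q (Least Q)"
    by (rule LeastI)
  \<comment> \<open>Candidate 0 is good, so the first failure has a positive number and the
    subtraction of 1 in \<open>right_end\<close> is not truncated.\<close>
  have "\<not> Q 0"
    using good by (simp add: Q_def)
  then obtain k0 where k0: "Least Q = Suc k0"
    using Q by (metis not0_implies_Suc)
  then have "\<not> Q k0"
    using not_less_Least[of k0 Q] by simp
  moreover have v: "v = b - real k0 * \<kappa>"
    using k0 by (simp add: v_def right_end_def Q_def[abs_def])
  ultimately show "good_right pr K \<delta> c v"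
    by (simp add: Q_def)
  then show "c < v" by (simp add: good_right_def)
  show "v \<le> b"
    using v \<open>\<kappa> > 0\<close> by simp
  show "\<not> good_right pr K \<delta> c (v - \<kappa>)"
    using Q k0 by (simp add: Q_def v algebra_simps)
qed

lemma left_end:
  assumes "\<kappa> > 0" and good: "good_left pr K \<delta> a c"
  defines "u \<equiv> left_end pr K \<delta> \<kappa> a c"
  shows "a \<le> u" "u < c" "good_left pr K \<delta> u c" "\<not> good_left pr K \<delta> (u + \<kappa>) c"
proof -
  define Q where "Q k \<longleftrightarrow> \<not> good_left pr K \<delta> (a + real k * \<kappa>) c" for k
  obtain k where "(c - a) / \<kappa> < real k"
    using reals_Archimedean2 by blast
  then have "Q k"
    using \<open>\<kappa> > 0\<close> by (simp add: Q_def good_left_def field_simps)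
  then have Q: "Q (Least Q)"
    by (rule LeastI)
  have "\<not> Q 0"
    using good by (simp add: Q_def)
  then obtain k0 where k0: "Least Q = Suc k0"
    using Q by (metis not0_implies_Suc)
  then have "\<not> Q k0"
    using not_less_Least[of k0 Q] by simp
  moreover have u: "u = a + real k0 * \<kappa>"
    using k0 by (simp add: u_def left_end_def Q_def[abs_def])
  ultimately show "good_left pr K \<delta> u c"
    by (simp add: Q_def)
  then show "u < c" by (simp add: good_left_def)
  show "a \<le> u"
    using u \<open>\<kappa> > 0\<close> by simp
  show "\<not> good_left pr K \<delta> (u + \<kappa>) c"
    using Q k0 by (simp add: Q_def u algebra_simps)
qed

section \<open>Measurability and error probabilities of the tests\<close>

context bisection
begin

lemma measurable_detector_K:
  assumes "a < b" and "i < length (upper_sets pr b)" and "j < length (lower_sets pr a)"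
  shows "detector_K pr K a b i j \<in> borel_measurable (obs_space K)"
proof -
  have [measurable]: "detector pr a b i j \<in> borel_measurable borel"
    by (rule measurable_detector[OF assms])
  show ?thesis
    unfolding detector_K_def[abs_def] by measurable
qed

text \<open>The vector chosen by \<open>SOME\<close> does not depend on \<open>\<omega>\<close>, so
  the test is a finite Boolean combination of inequalities between measurable sums and
  constants.\<close>

lemma measurable_right_test:
  assumes ab: "a < b"
  shows "right_test pr K a b \<in> measurable (obs_space K) (count_space UNIV)"
proof (cases "upper_feasible pr b")
  case False
  then show ?thesis by (simp add: right_test_def[abs_def])
next
  case True
  define m n where "m = length (upper_sets pr b)" and "n = length (lower_sets pr a)"
  define g h where "g = fst (SOME gh. perron_pair m n (risk_matrix pr K a b) gh)"
    and "h = snd (SOME gh. perron_pair m n (risk_matrix pr K a b) gh)"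
  have eq: "right_test pr K a b = (\<lambda>\<omega>. if \<exists>i\<in>{..<m}. \<forall>j\<in>{..<n}.
      0 \<le> detector_K pr K a b i j \<omega> - ln (h j) + ln (g i) then Right else Left)"
    using True by (simp add: fun_eq_iff right_test_def Let_def m_def n_def g_def h_def case_prod_beta Bex_def Ball_def)
  have "(\<lambda>\<omega>. detector_K pr K a b i j \<omega> - ln (h j) + ln (g i)) \<in> borel_measurable (obs_space K)"
    if "i \<in> {..<m}" "j \<in> {..<n}" for i j
    using measurable_detector_K[OF ab, of i j K] that by (simp add: m_def n_def)
  then have "Measurable.pred (obs_space K) (\<lambda>\<omega>. \<exists>i\<in>{..<m}. \<forall>j\<in>{..<n}.
      0 \<le> detector_K pr K a b i j \<omega> - ln (h j) + ln (g i))"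
    by (intro pred_intros_finite borel_measurable_pred_less borel_measurable_le) auto
  then show ?thesis
    unfolding eq by (intro measurable_If) (auto simp: pred_def)
qed

text \<open>Feasibility of both endpoints makes the risk matrix nonempty and \<open>a < b\<close>
  makes its entries positive; hence a Perron-Frobenius pair exists and the one chosen by
  \<open>SOME\<close> really is such a pair.\<close>

lemma right_test_eq:
  assumes ab: "a < b" and u: "upper_feasible pr b" and l: "lower_feasible pr a"
  obtains g h where
    "perron_pair (length (upper_sets pr b)) (length (lower_sets pr a)) (risk_matrix pr K a b) (g, h)"
    "\<And>\<omega>. right_test pr K a b \<omega> = Right \<longleftrightarrow>
      (\<exists>i<length (upper_sets pr b). \<forall>j<length (lower_sets pr a).
        0 \<le> detector_K pr K a b i j \<omega> - ln (h j) + ln (g i))"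
proof -
  define m n where "m = length (upper_sets pr b)" and "n = length (lower_sets pr a)"
  define gh where "gh = (SOME gh. perron_pair m n (risk_matrix pr K a b) gh)"
  have "\<exists>gh. perron_pair m n (risk_matrix pr K a b) gh"
    using perron_pair_exists[of m n "risk_matrix pr K a b"] u l pair_risk_pos[OF ab]
    by (metis lower_feasible_def m_def n_def risk_matrix_def upper_feasible_def zero_less_power)
  then have pp: "perron_pair m n (risk_matrix pr K a b) gh"
    unfolding gh_def by (rule someI_ex)
  show ?thesis
  proof (rule that[of "fst gh" "snd gh"])
    show "perron_pair (length (upper_sets pr b)) (length (lower_sets pr a)) (risk_matrix pr K a b) (fst gh, snd gh)"
      using pp by (simp add: m_def n_def)
    show "right_test pr K a b \<omega> = Right \<longleftrightarrow>
      (\<exists>i<length (upper_sets pr b). \<forall>j<length (lower_sets pr a).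
        0 \<le> detector_K pr K a b i j \<omega> - ln (snd gh j) + ln (fst gh i))" for \<omega>
      using u by (simp add: right_test_def Let_def m_def n_def gh_def case_prod_beta)
  qed
qed

lemma sets_Chernoff:
  fixes \<phi> :: "'w \<Rightarrow> real"
  assumes [measurable]: "\<phi> \<in> borel_measurable borel"
  shows "{\<omega>\<in>space (obs_space K). c \<le> (\<Sum>t=1..K. \<phi> (\<omega> t))} \<in> sets (obs_space K)"
  by measurable

text \<open>A signal in the upper piece \<open>i\<close> yields \<open>Left\<close> only if row
  \<open>i\<close> has a negative entry. Chernoff charges \<open>E i j * h j / g i\<close> to column
  \<open>j\<close>, and the eigenvector equation makes these charges sum to the spectral norm for
  every row.\<close>

lemma right_test_error_upper:
  assumes ab: "a < b" and l: "lower_feasible pr a" and x: "x \<in> signal_set pr" "b \<le> f x"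
  shows "measure (sample_law Ob K (A x)) {\<omega>\<in>space (obs_space K). right_test pr K a b \<omega> = Left}
    \<le> right_risk pr K a b"
proof -
  define m n where "m = length (upper_sets pr b)" and "n = length (lower_sets pr a)"
  let ?S = "sample_law Ob K (A x)"
  have Ax: "A x \<in> \<M>" using x signal_params by simp
  interpret prob_space ?S by (rule prob_space_sample_law[OF Ax])
  have u: "upper_feasible pr b" using x by (rule upper_feasibleI)
  obtain g h where pp: "perron_pair m n (risk_matrix pr K a b) (g, h)"
    and test: "\<And>\<omega>. right_test pr K a b \<omega> = Right \<longleftrightarrow>
      (\<exists>i<m. \<forall>j<n. 0 \<le> detector_K pr K a b i j \<omega> - ln (h j) + ln (g i))"
    unfolding m_def n_def by (rule right_test_eq[OF ab u l]) blast
  obtain i where i: "i < m" "x \<in> upper_sets pr b ! i"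
    unfolding m_def by (rule upper_set_cover[OF x])
  define B where "B j = {\<omega>\<in>space (obs_space K). ln (g i) - ln (h j) \<le> (\<Sum>t=1..K. - detector pr a b i j (\<omega> t))}" for j
  have det: "(\<lambda>\<omega>. - detector pr a b i j \<omega>) \<in> borel_measurable borel" if "j < n" for j
    using measurable_detector[OF ab, of i j] i that by (simp add: m_def n_def)
  have B: "B j \<in> sets ?S" if "j < n" for j
    unfolding sets_sample_law B_def by (rule sets_Chernoff) (rule det[OF that])
  have "{\<omega>\<in>space (obs_space K). right_test pr K a b \<omega> = Left} \<subseteq> (\<Union>j<n. B j)"
  proof safe
    fix \<omega> assume \<omega>: "\<omega> \<in> space (obs_space K)" "right_test pr K a b \<omega> = Left"
    then obtain j where j: "j < n" "detector_K pr K a b i j \<omega> - ln (h j) + ln (g i) < 0"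
      using test[of \<omega>] i(1) by (auto simp: not_le)
    then have "\<omega> \<in> B j"
      using \<omega>(1) by (simp add: B_def detector_K_def sum_negf)
    then show "\<omega> \<in> (\<Union>j<n. B j)"
      using j by auto
  qed
  then have "prob {\<omega>\<in>space (obs_space K). right_test pr K a b \<omega> = Left} \<le> prob (\<Union>j<n. B j)"
    using B by (intro finite_measure_mono) auto
  also have "\<dots> \<le> (\<Sum>j<n. prob (B j))"
    using B by (intro finite_measure_subadditive_finite) auto
  also have "\<dots> \<le> (\<Sum>j<n. risk_matrix pr K a b i j * h j / g i)"
  proof (rule sum_mono)
    fix j assume "j \<in> {..<n}"
    then have j: "j < n" by simp
    have gh: "0 < g i" "0 < h j"
      using pp i j by (auto simp: perron_pair_def)
    have "prob (B j) \<le> pair_risk pr a b i j ^ K * exp (- (ln (g i) - ln (h j)))"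
      unfolding B_def
      using i j ab by (intro Chernoff_sample_law Ax det detector_moment_upper) (auto simp: m_def n_def)
    also have "exp (- (ln (g i) - ln (h j))) = h j / g i"
      using gh by (simp add: exp_diff)
    finally show "prob (B j) \<le> risk_matrix pr K a b i j * h j / g i"
      by (simp add: risk_matrix_def)
  qed
  also have "\<dots> = (\<Sum>j<n. risk_matrix pr K a b i j * h j) / g i"
    by (simp add: sum_divide_distrib)
  also have "\<dots> = spectral_norm m n (risk_matrix pr K a b)"
    using pp i(1) by (auto simp: perron_pair_def field_simps)
  finally show ?thesis
    using u by (simp add: right_risk_def m_def n_def)
qed

text \<open>The column version: \<open>Right\<close> makes some row nonnegative, in particular its
  entry in the column \<open>j\<close> of the piece containing the signal. The charges over the rows
  sum up by the transposed eigenvector equation.\<close>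

lemma right_test_error_lower:
  assumes ab: "a < b" and u: "upper_feasible pr b" and x: "x \<in> signal_set pr" "f x \<le> a"
  shows "measure (sample_law Ob K (A x)) {\<omega>\<in>space (obs_space K). right_test pr K a b \<omega> = Right}
    \<le> right_risk pr K a b"
proof -
  define m n where "m = length (upper_sets pr b)" and "n = length (lower_sets pr a)"
  let ?S = "sample_law Ob K (A x)"
  have Ax: "A x \<in> \<M>" using x signal_params by simp
  interpret prob_space ?S by (rule prob_space_sample_law[OF Ax])
  have l: "lower_feasible pr a" using x by (rule lower_feasibleI)
  obtain g h where pp: "perron_pair m n (risk_matrix pr K a b) (g, h)"
    and test: "\<And>\<omega>. right_test pr K a b \<omega> = Right \<longleftrightarrow>
      (\<exists>i<m. \<forall>j<n. 0 \<le> detector_K pr K a b i j \<omega> - ln (h j) + ln (g i))"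
    unfolding m_def n_def by (rule right_test_eq[OF ab u l]) blast
  obtain j where j: "j < n" "x \<in> lower_sets pr a ! j"
    unfolding n_def by (rule lower_set_cover[OF x])
  define B where "B i = {\<omega>\<in>space (obs_space K). ln (h j) - ln (g i) \<le> (\<Sum>t=1..K. detector pr a b i j (\<omega> t))}" for i
  have det: "detector pr a b i j \<in> borel_measurable borel" if "i < m" for i
    using measurable_detector[OF ab, of i j] j that by (simp add: m_def n_def)
  have B: "B i \<in> sets ?S" if "i < m" for i
    unfolding sets_sample_law B_def by (rule sets_Chernoff) (rule det[OF that])
  have "{\<omega>\<in>space (obs_space K). right_test pr K a b \<omega> = Right} \<subseteq> (\<Union>i<m. B i)"
  proof safe
    fix \<omega> assume \<omega>: "\<omega> \<in> space (obs_space K)" "right_test pr K a b \<omega> = Right"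
    then obtain i where i: "i < m" "0 \<le> detector_K pr K a b i j \<omega> - ln (h j) + ln (g i)"
      using test[of \<omega>] j(1) by auto
    then have "\<omega> \<in> B i"
      using \<omega>(1) by (simp add: B_def detector_K_def)
    then show "\<omega> \<in> (\<Union>i<m. B i)"
      using i by auto
  qed
  then have "prob {\<omega>\<in>space (obs_space K). right_test pr K a b \<omega> = Right} \<le> prob (\<Union>i<m. B i)"
    using B by (intro finite_measure_mono) auto
  also have "\<dots> \<le> (\<Sum>i<m. prob (B i))"
    using B by (intro finite_measure_subadditive_finite) auto
  also have "\<dots> \<le> (\<Sum>i<m. risk_matrix pr K a b i j * g i / h j)"
  proof (rule sum_mono)
    fix i assume "i \<in> {..<m}"
    then have i: "i < m" by simp
    have gh: "0 < g i" "0 < h j"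
      using pp i j by (auto simp: perron_pair_def)
    have "prob (B i) \<le> pair_risk pr a b i j ^ K * exp (- (ln (h j) - ln (g i)))"
      unfolding B_def
      using i j ab by (intro Chernoff_sample_law Ax det detector_moment_lower) (auto simp: m_def n_def)
    also have "exp (- (ln (h j) - ln (g i))) = g i / h j"
      using gh by (simp add: exp_diff)
    finally show "prob (B i) \<le> risk_matrix pr K a b i j * g i / h j"
      by (simp add: risk_matrix_def)
  qed
  also have "\<dots> = (\<Sum>i<m. risk_matrix pr K a b i j * g i) / h j"
    by (simp add: sum_divide_distrib)
  also have "\<dots> = spectral_norm m n (risk_matrix pr K a b)"
    using pp j(1) by (auto simp: perron_pair_def field_simps)
  finally show ?thesis
    using u by (simp add: right_risk_def m_def n_def)
qed

section \<open>Measurability and error probability of Bisection\<close>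

lemma measurable_left_test:
  assumes "a < b"
  shows "left_test pr K a b \<in> measurable (obs_space K) (count_space UNIV)"
  using measurable_right_test[OF assms] by (simp add: left_test_def[abs_def])

text \<open>The discrete target is legitimate because \<open>\<omega>\<close> enters only through
  the verdicts, so the output takes finitely many values. Every predicate of the output then defines
  an event.\<close>

lemma measurable_bisect:
  assumes "a < b" and \<kappa>: "\<kappa> > 0"
  shows "(\<lambda>\<omega>. bisect pr K \<delta> \<kappa> \<omega> l (a, b)) \<in> measurable (obs_space K) (count_space UNIV)"
  using assms(1)
proof (induction l arbitrary: a b)
  case 0
  then show ?case by simp
next
  case (Suc l)
  define c where "c = (a + b) / 2"
  define u v where "u = left_end pr K \<delta> \<kappa> a c" and "v = right_end pr K \<delta> \<kappa> c b"
  have c: "a < c" "c < b" using Suc.prems by (auto simp: c_def)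
  note IH = Suc.IH[OF c(1)] Suc.IH[OF c(2)]
  consider "\<not> upper_feasible pr c" | "upper_feasible pr c" "\<not> lower_feasible pr c"
    | "upper_feasible pr c" "lower_feasible pr c" "\<not> (good_right pr K \<delta> c b \<and> good_left pr K \<delta> a c)"
    | "upper_feasible pr c" "lower_feasible pr c" "good_right pr K \<delta> c b" "good_left pr K \<delta> a c"
    by blast
  then show ?case
  proof cases
    case 4
    have uv: "u < c" "c < v"
      unfolding u_def v_def using left_end[OF \<kappa> 4(4)] right_end[OF \<kappa> 4(3)] by auto
    have eq: "(\<lambda>\<omega>. bisect pr K \<delta> \<kappa> \<omega> (Suc l) (a, b)) =
      (\<lambda>\<omega>. if right_test pr K c v \<omega> = Right
        then (if left_test pr K u c \<omega> = Right then bisect pr K \<delta> \<kappa> \<omega> l (c, b) else (u, v))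
        else (if left_test pr K u c \<omega> = Left then bisect pr K \<delta> \<kappa> \<omega> l (a, c) else (u, v)))"
      using 4 by (auto simp: fun_eq_iff Let_def c_def[symmetric] u_def[symmetric] v_def[symmetric] split: verdict.splits)
        (metis verdict.exhaust)
    note [measurable] = measurable_right_test[OF uv(2), of K] measurable_left_test[OF uv(1), of K] IH
    show ?thesis
      unfolding eq by measurable
  next
    case 3
    then have "(\<lambda>\<omega>. bisect pr K \<delta> \<kappa> \<omega> (Suc l) (a, b)) = (\<lambda>_. (a, b))"
      by (auto simp: Let_def c_def[symmetric])
    then show ?thesis by simp
  qed (use IH in \<open>simp_all add: Let_def c_def[symmetric]\<close>)
qed

lemma sets_bisect:
  assumes "a < b" and "\<kappa> > 0"
  shows "{\<omega>\<in>space (obs_space K). Q (bisect pr K \<delta> \<kappa> \<omega> l (a, b))} \<in> sets (obs_space K)"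
  using measurable_sets[OF measurable_bisect[OF assms], of "Collect Q" K \<delta> l]
  by (simp add: vimage_def Int_def conj_commute)

text \<open>If \<open>f x\<close> is the midpoint \<open>c\<close>, both halves contain it and the segments of the later steps are
  no longer determined by \<open>x\<close>. The induction survives because continuing at all is then as
  unlikely as an error: two equal verdicts are wrong for one of the two tests.\<close>

lemma bisect_error:
  assumes x: "x \<in> signal_set pr" and "a < b" and "a \<le> f x" "f x \<le> b"
    and \<kappa>: "\<kappa> > 0" and \<delta>: "0 \<le> \<delta>"
  shows "measure (sample_law Ob K (A x))
    {\<omega>\<in>space (obs_space K). \<not> (case bisect pr K \<delta> \<kappa> \<omega> l (a, b) of (u, v) \<Rightarrow> f x \<in> {u..v})}
    \<le> 2 * \<delta> * real l"
  using assms(2-4)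
proof (induction l arbitrary: a b)
  case 0
  then show ?case by simp
next
  case (Suc l)
  let ?S = "sample_law Ob K (A x)"
  have Ax: "A x \<in> \<M>" using x signal_params by simp
  interpret prob_space ?S by (rule prob_space_sample_law[OF Ax])
  define bad where "bad l a b = {\<omega>\<in>space (obs_space K).
    \<not> (case bisect pr K \<delta> \<kappa> \<omega> l (a, b) of (u, v) \<Rightarrow> f x \<in> {u..v})}" for l a b
  have bad_sets: "bad l a b \<in> sets ?S" if "a < b" for l a b
    unfolding sets_sample_law bad_def using that \<kappa> by (rule sets_bisect)
  define c where "c = (a + b) / 2"
  define u v where "u = left_end pr K \<delta> \<kappa> a c" and "v = right_end pr K \<delta> \<kappa> c b"
  have c: "a < c" "c < b" using Suc.prems by (auto simp: c_def)
  have IHl: "prob (bad l a c) \<le> 2 * \<delta> * real l" if "f x \<le> c"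
    unfolding bad_def using that Suc.prems c by (intro Suc.IH) auto
  have IHr: "prob (bad l c b) \<le> 2 * \<delta> * real l" if "c \<le> f x"
    unfolding bad_def using that Suc.prems c by (intro Suc.IH) auto
  have mono: "2 * \<delta> * real l \<le> 2 * \<delta> * real (Suc l)"
    using \<delta> by (simp add: algebra_simps)
  have "prob (bad (Suc l) a b) \<le> 2 * \<delta> * real (Suc l)"
  proof (cases "upper_feasible pr c \<and> lower_feasible pr c \<and> good_right pr K \<delta> c b \<and> good_left pr K \<delta> a c")
    case False
    then consider "\<not> upper_feasible pr c" | "upper_feasible pr c" "\<not> lower_feasible pr c"
      | "upper_feasible pr c" "lower_feasible pr c" "\<not> (good_right pr K \<delta> c b \<and> good_left pr K \<delta> a c)"
      by blast
    then show ?thesis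
    proof cases
      case 1
      then have "f x \<le> c" using upper_feasibleI[OF x, of c] by linarith
      moreover have "bad (Suc l) a b = bad l a c"
        using 1 by (simp add: bad_def Let_def c_def[symmetric])
      ultimately show ?thesis using IHl mono by simp
    next
      case 2
      then have "c \<le> f x" using lower_feasibleI[OF x, of c] by linarith
      moreover have "bad (Suc l) a b = bad l c b"
        using 2 by (simp add: bad_def Let_def c_def[symmetric])
      ultimately show ?thesis using IHr mono by simp
    next
      case 3
      then have "bad (Suc l) a b = {}"
        using Suc.prems by (auto simp: bad_def Let_def c_def[symmetric])
      then show ?thesis using \<delta> by simp
    qed
  next
    case True
    then have feas: "upper_feasible pr c" "lower_feasible pr c" by auto
    have uv: "u < c" "c < v" and gv: "right_risk pr K c v \<le> \<delta>" and gu: "left_risk pr K u c \<le> \<delta>"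
      unfolding u_def v_def using True left_end[OF \<kappa>, of pr K \<delta> a c] right_end[OF \<kappa>, of pr K \<delta> c b]
      by (auto simp: good_left_def good_right_def)
    define RR RL LR LL where "RR = {\<omega>\<in>space (obs_space K). right_test pr K c v \<omega> = Right}"
      and "RL = {\<omega>\<in>space (obs_space K). right_test pr K c v \<omega> = Left}"
      and "LR = {\<omega>\<in>space (obs_space K). left_test pr K u c \<omega> = Right}"
      and "LL = {\<omega>\<in>space (obs_space K). left_test pr K u c \<omega> = Left}"
    have sets: "RR \<in> sets ?S" "RL \<in> sets ?S" "LR \<in> sets ?S" "LL \<in> sets ?S"
    proof -
      note [measurable] = measurable_right_test[OF uv(2), of K] measurable_left_test[OF uv(1), of K]
      show "RR \<in> sets ?S" "RL \<in> sets ?S" "LR \<in> sets ?S" "LL \<in> sets ?S"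
        unfolding sets_sample_law RR_def RL_def LR_def LL_def by measurable
    qed
    \<comment> \<open>In this and the next three bounds, an infeasible outer endpoint makes the test
      constant and the error event empty; otherwise the risk of the test applies.\<close>
    have RR: "prob RR \<le> \<delta>" if "f x \<le> c"
    proof (cases "upper_feasible pr v")
      case True
      then show ?thesis
        using right_test_error_lower[OF uv(2) True x that, of K] gv by (simp add: RR_def)
    next
      case False
      then show ?thesis using \<delta> by (simp add: RR_def right_test_def)
    qed
    have RL: "prob RL \<le> \<delta>" if "v \<le> f x"
      using right_test_error_upper[OF uv(2) feas(2) x that, of K] gv by (simp add: RL_def)
    have LL: "prob LL \<le> \<delta>" if "c \<le> f x"
    proof (cases "lower_feasible pr u")
      case True
      then show ?thesis
        using right_test_error_upper[OF uv(1) True x that, of K] gu by (simp add: LL_def left_test_def left_risk_def)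
    next
      case False
      then show ?thesis using \<delta> by (simp add: LL_def left_test_def)
    qed
    have LR: "prob LR \<le> \<delta>" if "f x \<le> u"
    proof -
      have "lower_feasible pr u" using x that by (rule lower_feasibleI)
      then show ?thesis
        using right_test_error_lower[OF uv(1) feas(1) x that, of K] gu
        by (simp add: LR_def left_test_def left_risk_def)
    qed
    have step: "bisect pr K \<delta> \<kappa> \<omega> (Suc l) (a, b) =
        (if right_test pr K c v \<omega> = left_test pr K u c \<omega>
         then (case right_test pr K c v \<omega> of
            Right \<Rightarrow> bisect pr K \<delta> \<kappa> \<omega> l (c, b) | Left \<Rightarrow> bisect pr K \<delta> \<kappa> \<omega> l (a, c))
         else (u, v))" for \<omega>
      using True by (simp add: Let_def c_def[symmetric] u_def[symmetric] v_def[symmetric])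
    \<comment> \<open>The output misses \<open>f x\<close> either later on, after two equal
      verdicts, or at once, after different verdicts with \<open>f x\<close> outside
      \<open>[u, v]\<close>.\<close>
    have out: "bad (Suc l) a b \<subseteq> (RR \<inter> LR \<inter> bad l c b) \<union> (RL \<inter> LL \<inter> bad l a c)
        \<union> {\<omega> \<in> (RR \<inter> LL) \<union> (RL \<inter> LR). f x < u \<or> v < f x}"
    proof
      fix \<omega> assume "\<omega> \<in> bad (Suc l) a b"
      then show "\<omega> \<in> (RR \<inter> LR \<inter> bad l c b) \<union> (RL \<inter> LL \<inter> bad l a c)
        \<union> {\<omega> \<in> (RR \<inter> LL) \<union> (RL \<inter> LR). f x < u \<or> v < f x}"
        by (cases "right_test pr K c v \<omega>"; cases "left_test pr K u c \<omega>")
          (auto simp: bad_def step RR_def RL_def LR_def LL_def not_le simp del: bisect.simps)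
    qed
    \<comment> \<open>\<open>E1\<close> and \<open>E2\<close> are charged to the two tests of this
      step, \<open>E3\<close> to the remaining \<open>l\<close> steps.\<close>
    have union: "prob (bad (Suc l) a b) \<le> 2 * \<delta> * real (Suc l)"
      if sub: "bad (Suc l) a b \<subseteq> E1 \<union> E2 \<union> E3" and E: "E1 \<in> sets ?S" "E2 \<in> sets ?S" "E3 \<in> sets ?S"
        and le: "prob E1 \<le> \<delta>" "prob E2 \<le> \<delta>" "prob E3 \<le> 2 * \<delta> * real l" for E1 E2 E3
    proof -
      have "prob (bad (Suc l) a b) \<le> prob (E1 \<union> E2 \<union> E3)"
        using sub E by (intro finite_measure_mono) auto
      also have "\<dots> \<le> prob (E1 \<union> E2) + prob E3"
        using E by (intro measure_Un_le) auto
      also have "\<dots> \<le> prob E1 + prob E2 + prob E3"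
        using E by (intro add_right_mono measure_Un_le)
      also have "\<dots> \<le> 2 * \<delta> * real (Suc l)"
        using le by (simp add: algebra_simps)
      finally show ?thesis .
    qed
    \<comment> \<open>Between \<open>u\<close> and \<open>v\<close> stopping is harmless, so away
      from \<open>c\<close> only the verdict towards the wrong half is charged. Below
      \<open>u\<close> or above \<open>v\<close> the true verdict is determined for both tests, and
      a mistaken stop means that one of them erred.\<close>
    consider "f x < u" | "u \<le> f x" "f x < c" | "f x = c" | "c < f x" "f x \<le> v" | "v < f x"
      by linarith
    then show ?thesis
    proof cases
      case 1
      have "bad (Suc l) a b \<subseteq> RR \<union> LR \<union> bad l a c"
        using out by blast
      then show ?thesis
        using 1 uv c by (intro union[of RR LR]) (auto intro!: sets bad_sets RR LR IHl)
    next
      case 2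
      have "bad (Suc l) a b \<subseteq> RR \<union> {} \<union> bad l a c"
        using out 2 uv by fastforce
      then show ?thesis
        using 2 uv c \<delta> by (intro union[of RR "{}"]) (auto intro!: sets bad_sets RR IHl)
    next
      case 3
      have "bad (Suc l) a b \<subseteq> RR \<union> LL \<union> {}"
        using out 3 uv by fastforce
      then show ?thesis
        using 3 uv c \<delta> by (intro union[of RR LL "{}"]) (auto intro!: sets RR LL)
    next
      case 4
      have "bad (Suc l) a b \<subseteq> LL \<union> {} \<union> bad l c b"
        using out 4 uv by fastforce
      then show ?thesis
        using 4 uv c \<delta> by (intro union[of LL "{}"]) (auto intro!: sets bad_sets LL IHr)
    next
      case 5
      have "bad (Suc l) a b \<subseteq> RL \<union> LL \<union> bad l c b"
        using out by blast
      then show ?thesis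
        using 5 uv c by (intro union[of RL LL]) (auto intro!: sets bad_sets RL LL IHr)
    qed
  qed
  then show ?case by (simp add: bad_def)
qed

lemma bisect_reliable:
  assumes x: "x \<in> signal_set pr" and ab: "a < b" and "a \<le> f x" "f x \<le> b"
    and \<kappa>: "\<kappa> > 0" and \<epsilon>: "0 < \<epsilon>" and L: "L \<ge> 1"
  shows "1 - \<epsilon> \<le> measure (sample_law Ob K (A x))
    {\<omega>\<in>space (sample_law Ob K (A x)).
      case bisect pr K (\<epsilon> / (2 * real L)) \<kappa> \<omega> L (a, b) of (u, v) \<Rightarrow> f x \<in> {u..v}}"
proof -
  let ?S = "sample_law Ob K (A x)" and ?\<delta> = "\<epsilon> / (2 * real L)"
  have Ax: "A x \<in> \<M>" using x signal_params by simp
  interpret prob_space ?S by (rule prob_space_sample_law[OF Ax])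
  have "{\<omega>\<in>space ?S. case bisect pr K ?\<delta> \<kappa> \<omega> L (a, b) of (u, v) \<Rightarrow> f x \<in> {u..v}} \<in> events"
    unfolding space_sample_law sets_sample_law using ab \<kappa> by (rule sets_bisect)
  note prob_neg = prob_neg[OF this]
  have "prob {\<omega>\<in>space ?S. \<not> (case bisect pr K ?\<delta> \<kappa> \<omega> L (a, b) of (u, v) \<Rightarrow> f x \<in> {u..v})} \<le> 2 * ?\<delta> * real L"
    unfolding space_sample_law using assms by (intro bisect_error) auto
  also have "\<dots> = \<epsilon>" using L by simp
  finally show ?thesis
    using prob_neg by simp
qed

end

subsection \<open>Near-optimality\<close>

text \<open>Tensorization: the root of the product density factorizes, and so does its integral.
  This links a bound from repeated observations to the affinity of a single one.\<close>

lemma (in good_scheme) affinity_power: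
  assumes "\<mu> \<in> \<M>" "\<nu> \<in> \<M>"
  shows "(\<integral>\<omega>. sqrt ((\<Prod>t\<in>{1..K}. p \<mu> (\<omega> t)) * (\<Prod>t\<in>{1..K}. p \<nu> (\<omega> t))) \<partial>PiM {1..K} (\<lambda>_. P))
    = affinity Ob \<mu> \<nu> ^ K"
proof -
  interpret product_sigma_finite "\<lambda>_::nat. P" by (rule product_P)
  have "sqrt (\<Prod>t\<in>T. g t) = (\<Prod>t\<in>T. sqrt (g t))" for g :: "nat \<Rightarrow> real" and T
    by (induction T rule: infinite_finite_induct) (auto simp: real_sqrt_mult)
  then have "sqrt ((\<Prod>t\<in>{1..K}. p \<mu> (\<omega> t)) * (\<Prod>t\<in>{1..K}. p \<nu> (\<omega> t)))
      = (\<Prod>t\<in>{1..K}. sqrt (p \<mu> (\<omega> t) * p \<nu> (\<omega> t)))" for \<omega>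
    by (simp add: prod.distrib flip: prod.distrib)
  then show ?thesis
    using product_integral_prod[of "{1..K}" "\<lambda>_ \<omega>. sqrt (p \<mu> \<omega> * p \<nu> \<omega>)"] integrable_affinity[OF assms]
    by (simp add: affinity_def)
qed

lemma (in good_scheme) sample_law_density:
  assumes \<mu>: "\<mu> \<in> \<M>"
  shows "sample_law Ob K \<mu> = density (PiM {1..K} (\<lambda>_. P)) (\<lambda>\<omega>. ennreal (\<Prod>t\<in>{1..K}. p \<mu> (\<omega> t)))"
proof -
  have [measurable]: "p \<mu> \<in> borel_measurable P"
    using integrable_dens[OF \<mu>] by auto
  show ?thesis
    unfolding sample_law_def
    using PiM_density[of "{1..K}" "\<lambda>_. P" "\<lambda>_ \<omega>. ennreal (p \<mu> \<omega>)", OF _ product_P product_law[OF \<mu>]]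
      dens_pos[OF \<mu>] by (simp add: prod_ennreal less_imp_le)
qed

lemma (in good_scheme) integrable_product_dens:
  fixes K :: nat
  assumes \<mu>: "\<mu> \<in> \<M>"
  shows "integrable (PiM {1..K} (\<lambda>_. P)) (\<lambda>\<omega>. \<Prod>t\<in>{1..K}. p \<mu> (\<omega> t))"
    and "(\<integral>\<omega>. (\<Prod>t\<in>{1..K}. p \<mu> (\<omega> t)) \<partial>PiM {1..K} (\<lambda>_. P)) = 1"
proof -
  interpret product_sigma_finite "\<lambda>_::nat. P" by (rule product_P)
  show "integrable (PiM {1..K} (\<lambda>_. P)) (\<lambda>\<omega>. \<Prod>t\<in>{1..K}. p \<mu> (\<omega> t))"
    using product_integrable_prod[of "{1..K}" "\<lambda>_. p \<mu>"] \<mu> by (simp add: integrable_dens)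
  show "(\<integral>\<omega>. (\<Prod>t\<in>{1..K}. p \<mu> (\<omega> t)) \<partial>PiM {1..K} (\<lambda>_. P)) = 1"
    using product_integral_prod[of "{1..K}" "\<lambda>_. p \<mu>"] \<mu> by (simp add: integrable_dens integral_dens)
qed

lemma (in good_scheme) sets_PiM_P: "sets (PiM {1..K} (\<lambda>_. P)) = sets (obs_space K)"
  by (intro sets_PiM_cong) (auto simp: sets_P)

lemma (in good_scheme) measure_sample_law:
  assumes \<mu>: "\<mu> \<in> \<M>" and S: "S \<in> sets (obs_space K)"
  shows "measure (sample_law Ob K \<mu>) S
    = (\<integral>\<omega>. (\<Prod>t\<in>{1..K}. p \<mu> (\<omega> t)) * indicator S \<omega> \<partial>PiM {1..K} (\<lambda>_. P))"
proof -
  have "measure (sample_law Ob K \<mu>) S = (\<integral>\<omega>. indicator S \<omega> \<partial>sample_law Ob K \<mu>)"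
    using S sets.sets_into_space[OF S] by (simp add: space_sample_law Int_absorb2)
  also have "\<dots> = (\<integral>\<omega>. (\<Prod>t\<in>{1..K}. p \<mu> (\<omega> t)) * indicator S \<omega> \<partial>PiM {1..K} (\<lambda>_. P))"
    unfolding sample_law_density[OF \<mu>]
    using S integrable_product_dens(1)[OF \<mu>, of K] dens_pos[OF \<mu>]
    by (subst integral_real_density) (auto simp: sets_PiM_P intro!: AE_I2 prod_nonneg intro: less_imp_le)
  finally show ?thesis .
qed

text \<open>With \<open>x = 4 * \<epsilon> * (1 - \<epsilon>)\<close>, the hypotheses become
  \<open>2 * k * ln a \<le> ln x\<close> and \<open>2 * k * ln T \<le> - K * ln x\<close>, which
  combine to \<open>K * ln a \<le> - ln T\<close>.\<close>

lemma power_le_of_affinity: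
  fixes \<epsilon> :: real and a T :: real
  assumes \<epsilon>: "0 < \<epsilon>" "\<epsilon> < 1/2" and a: "0 < a" and T: "0 < T" and k: "1 \<le> k"
    and le: "(a ^ k)\<^sup>2 \<le> 4 * \<epsilon> * (1 - \<epsilon>)"
    and K: "2 * ln T / ln (1 / (4 * \<epsilon> * (1 - \<epsilon>))) * real k \<le> real K"
  shows "a ^ K \<le> 1 / T"
proof -
  define x where "x = 4 * \<epsilon> * (1 - \<epsilon>)"
  \<comment> \<open>This form shows \<open>x < 1\<close>, so the logarithm in the denominator of the
    bound on \<open>K\<close> is positive.\<close>
  have "x = 1 - (1 - 2 * \<epsilon>)\<^sup>2"
    by (simp add: x_def power2_eq_square algebra_simps)
  moreover have "0 < (1 - 2 * \<epsilon>)\<^sup>2"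
    using \<epsilon> by simp
  ultimately have "x < 1" by simp
  then have x: "0 < x" "x < 1"
    using \<epsilon> by (simp_all add: x_def)
  define c where "c = - ln x"
  have c: "0 < c" using x by (simp add: c_def)
  have "ln ((a ^ k)\<^sup>2) \<le> ln x"
    using le a by (intro ln_mono) (auto simp: x_def)
  then have lna: "2 * real k * ln a \<le> - c"
    using a by (simp add: c_def ln_realpow)
  have "ln (1 / x) = c"
    using x by (simp add: c_def ln_div)
  then have "2 * ln T / c * real k \<le> real K"
    using K by (simp add: x_def)
  then have "2 * ln T * real k \<le> real K * c"
    using c by (simp add: field_simps)
  also have "real K * c \<le> real K * - (2 * real k * ln a)"
    using lna by (intro mult_left_mono) auto
  finally have "real k * ln T \<le> real k * - (real K * ln a)"
    by (simp add: algebra_simps)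
  then have "real K * ln a \<le> - ln T"
    using k by (subst (asm) mult_le_cancel_left_pos) auto
  then have "exp (real K * ln a) \<le> exp (- ln T)" by simp
  then show ?thesis
    using a T by (simp add: exp_minus exp_of_nat_mult inverse_eq_divide)
qed

section \<open>From a reliable estimate to short output segments\<close>

context bisection
begin

text \<open>A two-point argument: the events that the estimate is \<open>\<rho>\<close>-close to
  \<open>f r\<close> and to \<open>f s\<close> are disjoint, so closeness to \<open>f r\<close> is a
  test of \<open>r\<close> against \<open>s\<close> with both error probabilities at most
  \<open>\<epsilon>\<close>.\<close>

lemma affinity_le_of_reliable:
  assumes rel: "reliable pr f k \<rho> \<epsilon> fhat" and \<epsilon>: "\<epsilon> < 1/2"
    and r: "r \<in> signal_set pr" and s: "s \<in> signal_set pr" and far: "2 * \<rho> < f r - f s"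
  shows "(affinity Ob (A r) (A s) ^ k)\<^sup>2 \<le> 4 * \<epsilon> * (1 - \<epsilon>)"
proof -
  have [measurable]: "fhat \<in> borel_measurable (obs_space k)"
    using rel by (simp add: reliable_def)
  define G where "G x = {\<omega>\<in>space (obs_space k). \<bar>fhat \<omega> - f x\<bar> \<le> \<rho>}" for x
  have G: "G x \<in> sets (obs_space k)" for x
    unfolding G_def by measurable
  have prob: "1 - \<epsilon> \<le> measure (sample_law Ob k (A x)) (G x)" if "x \<in> signal_set pr" for x
    using rel that by (simp add: reliable_def G_def space_sample_law)
  note M = signal_params[OF r] signal_params[OF s]
  interpret s: prob_space "sample_law Ob k (A s)"
    by (rule prob_space_sample_law[OF M(2)])
  have "measure (sample_law Ob k (A s)) (G r) + measure (sample_law Ob k (A s)) (G s)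
      = measure (sample_law Ob k (A s)) (G r \<union> G s)"
    using far G by (intro s.finite_measure_Union[symmetric]) (auto simp: sets_sample_law, auto simp: G_def)
  also have "\<dots> \<le> 1" by simp
  finally have small: "measure (sample_law Ob k (A s)) (G r) \<le> \<epsilon>"
    using prob[OF s] by simp
  have nn: "0 \<le> (\<Prod>t\<in>{1..k}. p \<mu> (\<omega> t))" if "\<mu> \<in> \<M>" for \<mu> \<omega>
    using dens_pos[OF that] by (intro prod_nonneg) (auto simp: less_imp_le)
  show ?thesis
    unfolding affinity_power[OF M, symmetric]
    using small prob[OF r] \<epsilon> G M
    by (intro affinity_le_of_test[where S="G r"] integrable_product_dens nn)
      (auto simp: measure_sample_law sets_PiM_P)
qed

lemma right_risk_le_of_reliable:
  assumes rel: "reliable pr f k \<rho> \<epsilon> fhat" and k: "1 \<le> k" and \<epsilon>: "0 < \<epsilon>" "\<epsilon> < 1/2"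
    and ab: "2 * \<rho> < b - a" "a < b" and l: "lower_feasible pr a" and L: "1 \<le> L"
    and K: "2 * ln (2 * real L * real N * real I / \<epsilon>) / ln (1 / (4 * \<epsilon> * (1 - \<epsilon>))) * real k \<le> real K"
  shows "right_risk pr K a b \<le> \<epsilon> / (2 * real L)"
proof (cases "upper_feasible pr b")
  case False
  then show ?thesis using \<epsilon> by (simp add: right_risk_def)
next
  case True
  define m n where "m = length (upper_sets pr b)" and "n = length (lower_sets pr a)"
  \<comment> \<open>\<open>T\<close> is \<open>N * I / \<delta>\<close> for
    \<open>\<delta> = \<epsilon> / (2 * L)\<close>: entries of size \<open>1 / T\<close>, multiplied
    by \<open>N * I\<close>, give exactly \<open>\<delta>\<close>.\<close>
  define T where "T = 2 * real L * real N * real I / \<epsilon>"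
  have mn: "m \<le> I * N" "n \<le> I * N"
    unfolding m_def n_def by (rule length_upper_sets length_lower_sets)+
  moreover have "0 < m"
    using True by (simp add: m_def upper_feasible_def)
  \<comment> \<open>A nonempty upper piece forces \<open>I\<close> and \<open>N\<close> to be
    positive, hence \<open>T > 0\<close>.\<close>
  ultimately have IN: "0 < I * N" by linarith
  have T: "0 < T"
    using IN L \<epsilon> by (simp add: T_def)
  have "\<bar>risk_matrix pr K a b i j\<bar> \<le> 1 / T" if "i < m" "j < n" for i j
  proof -
    note ij = that[unfolded m_def n_def]
    let ?r = "pt_r a b i j" and ?s = "pt_s a b i j"
    have rs: "?r \<in> signal_set pr" "?s \<in> signal_set pr" "b \<le> f ?r" "f ?s \<le> a"
      using selection(1,2)[OF ab(2) ij] upper_set(4)[OF ij(1)] lower_set(4)[OF ij(2)] by auto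
    have "(pair_risk pr a b i j ^ k)\<^sup>2 \<le> 4 * \<epsilon> * (1 - \<epsilon>)"
      unfolding pair_risk_eq using rs ab(1)
      by (intro affinity_le_of_reliable[OF rel \<epsilon>(2)]) auto
    then have "pair_risk pr a b i j ^ K \<le> 1 / T"
      using K T k \<epsilon> pair_risk_pos[OF ab(2) ij] unfolding T_def by (intro power_le_of_affinity)
    then show ?thesis
      using pair_risk_pos[OF ab(2) ij] by (simp add: risk_matrix_def)
  qed
  then have "right_risk pr K a b \<le> sqrt (real (m * n)) * (1 / T)"
    using True T spectral_norm_le[of m n "risk_matrix pr K a b" "1 / T"]
    by (simp add: right_risk_def m_def[symmetric] n_def[symmetric])
  also have "\<dots> \<le> real (I * N) * (1 / T)"
  proof (rule mult_right_mono)
    have "real (m * n) \<le> (real (I * N))\<^sup>2"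
      using mult_mono[OF mn] by (simp add: power2_eq_square flip: of_nat_mult)
    then show "sqrt (real (m * n)) \<le> real (I * N)"
      by (intro real_le_lsqrt) auto
  qed (use T in simp)
  also have "\<dots> = \<epsilon> / (2 * real L)"
    using IN L \<epsilon> by (simp add: T_def field_simps)
  finally show ?thesis .
qed

text \<open>A statement about every \<open>\<omega>\<close>: the length is at most
  \<open>2 * \<rho> * 2 ^ l\<close> with \<open>l\<close> steps left, so it is small enough when the
  steps run out. The premise \<open>long\<close> handles the early exits, where lack of goodness
  certifies that a segment is short.\<close>

lemma bisect_length:
  assumes long: "\<And>a b. 2 * \<rho>' < b - a \<Longrightarrow> a < b \<Longrightarrow> lower_feasible pr a \<Longrightarrow> right_risk pr K a b \<le> \<delta>"
    and \<delta>: "0 \<le> \<delta>" and \<rho>': "0 < \<rho>'" and \<rho>: "2 * \<rho>' < \<rho>"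
    and ab: "a < b" "b - a \<le> 2 * \<rho> * 2 ^ l"
    and uv: "bisect pr K \<delta> (\<rho> - 2 * \<rho>') \<omega> l (a, b) = (u, v)"
  shows "v - u \<le> 2 * \<rho>"
  using ab uv
proof (induction l arbitrary: a b)
  case 0
  then show ?case by simp
next
  case (Suc l)
  let ?\<kappa> = "\<rho> - 2 * \<rho>'"
  define c where "c = (a + b) / 2"
  define u' v' where "u' = left_end pr K \<delta> ?\<kappa> a c" and "v' = right_end pr K \<delta> ?\<kappa> c b"
  have \<kappa>: "0 < ?\<kappa>" using \<rho> by simp
  have c: "a < c" "c < b" "c - a = (b - a) / 2" "b - c = (b - a) / 2"
    using Suc.prems by (auto simp: c_def field_simps)
  have half: "c - a \<le> 2 * \<rho> * 2 ^ l" "b - c \<le> 2 * \<rho> * 2 ^ l"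
    using Suc.prems(2) unfolding c(3,4) by auto
  note IH = Suc.IH[OF c(1) half(1)] Suc.IH[OF c(2) half(2)]
  \<comment> \<open>A segment that is not good either has risk above \<open>\<delta>\<close>, which
    \<open>long\<close> excludes beyond length \<open>2 * \<rho>'\<close>, or has no positive
    length.\<close>
  have right: "b' - c \<le> 2 * \<rho>'" if "\<not> good_right pr K \<delta> c b'" "lower_feasible pr c" for b'
    using long[where a=c and b=b'] that \<rho>' by (force simp: good_right_def)
  have left: "c - a' \<le> 2 * \<rho>'" if "\<not> good_left pr K \<delta> a' c" "upper_feasible pr c" for a'
    using long[where a=a' and b=c] that \<rho>' \<delta> by (force simp: good_left_def left_risk_def split: if_splits)
  consider "\<not> upper_feasible pr c" | "upper_feasible pr c" "\<not> lower_feasible pr c"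
    | "upper_feasible pr c" "lower_feasible pr c" "\<not> (good_right pr K \<delta> c b \<and> good_left pr K \<delta> a c)"
    | "upper_feasible pr c" "lower_feasible pr c" "good_right pr K \<delta> c b" "good_left pr K \<delta> a c"
    by blast
  then show ?case
  proof cases
    case 1
    then show ?thesis
      using IH(1) Suc.prems(3) by (simp add: Let_def c_def[symmetric])
  next
    case 2
    then show ?thesis
      using IH(2) Suc.prems(3) by (simp add: Let_def c_def[symmetric])
  next
    case 3
    then have "u = a" "v = b"
      using Suc.prems(3) by (auto simp: Let_def c_def[symmetric] split: if_splits)
    \<comment> \<open>The two halves are equally long, so one short half bounds the whole segment by
      \<open>4 * \<rho>'\<close>, which is less than \<open>2 * \<rho>\<close>.\<close>
    moreover have "b - c \<le> 2 * \<rho>' \<or> c - a \<le> 2 * \<rho>'"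
      using 3 right left by blast
    ultimately show ?thesis
      using c \<rho> by auto
  next
    case 4
    have "v' - ?\<kappa> - c \<le> 2 * \<rho>'"
      using right_end(4)[OF \<kappa> 4(3)] 4(2) unfolding v'_def by (intro right)
    moreover have "c - (u' + ?\<kappa>) \<le> 2 * \<rho>'"
      using left_end(4)[OF \<kappa> 4(4)] 4(1) unfolding u'_def by (intro left)
    ultimately have "v' - u' \<le> 2 * \<rho>" by simp
    then show ?thesis
      using IH Suc.prems(3) 4
      by (auto simp: Let_def c_def[symmetric] u'_def[symmetric] v'_def[symmetric]
        split: if_splits verdict.splits)
  qed
qed

lemma reliable_const:
  assumes "\<And>x. x \<in> signal_set pr \<Longrightarrow> \<bar>y - f x\<bar> \<le> \<rho>" and "0 \<le> \<epsilon>"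
  shows "reliable pr f K \<rho> \<epsilon> (\<lambda>_. y)"
proof -
  have "1 - \<epsilon> \<le> measure (sample_law Ob K (A x)) {\<omega> \<in> space (sample_law Ob K (A x)). \<bar>y - f x\<bar> \<le> \<rho>}"
    if x: "x \<in> signal_set pr" for x
  proof -
    interpret prob_space "sample_law Ob K (A x)"
      by (rule prob_space_sample_law[OF signal_params[OF x]])
    show ?thesis
      using assms x prob_space by simp
  qed
  then show ?thesis by (simp add: reliable_def)
qed

text \<open>A segment of length at most \<open>2 * \<rho>\<close> that contains \<open>f x\<close>
  has its midpoint within \<open>\<rho>\<close> of \<open>f x\<close>, so the confidence of the
  segment carries over to the estimate.\<close>

lemma midpoint_estimate_reliable:
  assumes ab: "a < b" and range: "\<And>x. x \<in> signal_set pr \<Longrightarrow> a \<le> f x \<and> f x \<le> b"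
    and \<epsilon>: "0 < \<epsilon>" and \<kappa>: "\<kappa> > 0" and L: "L \<ge> 1"
    and len: "\<And>x \<omega> u v. x \<in> signal_set pr \<Longrightarrow>
      bisect pr K (\<epsilon> / (2 * real L)) \<kappa> \<omega> L (a, b) = (u, v) \<Longrightarrow> v - u \<le> 2 * \<rho>"
  shows "reliable pr f K \<rho> \<epsilon> (midpoint_estimate pr K L (\<epsilon> / (2 * real L)) \<kappa> a b)"
proof -
  let ?\<delta> = "\<epsilon> / (2 * real L)"
  let ?m = "midpoint_estimate pr K L ?\<delta> \<kappa> a b"
  have "(\<lambda>z. case z of (u, v) \<Rightarrow> ((u + v) / 2 :: real)) \<in> measurable (count_space UNIV) borel"
    by simp
  from measurable_compose[OF measurable_bisect[OF ab \<kappa>] this]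
  have m [measurable]: "?m \<in> borel_measurable (obs_space K)"
    unfolding midpoint_estimate_def[abs_def] Let_def by simp
  have "1 - \<epsilon> \<le> measure (sample_law Ob K (A x)) {\<omega> \<in> space (sample_law Ob K (A x)). \<bar>?m \<omega> - f x\<bar> \<le> \<rho>}"
    if x: "x \<in> signal_set pr" for x
  proof -
    interpret prob_space "sample_law Ob K (A x)"
      by (rule prob_space_sample_law[OF signal_params[OF x]])
    have "1 - \<epsilon> \<le> prob {\<omega>\<in>space (sample_law Ob K (A x)).
        case bisect pr K ?\<delta> \<kappa> \<omega> L (a, b) of (u, v) \<Rightarrow> f x \<in> {u..v}}"
      using x ab range \<kappa> \<epsilon> L by (intro bisect_reliable) auto
    also have "\<dots> \<le> prob {\<omega> \<in> space (sample_law Ob K (A x)). \<bar>?m \<omega> - f x\<bar> \<le> \<rho>}"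
    proof (rule finite_measure_mono)
      show "{\<omega> \<in> space (sample_law Ob K (A x)). \<bar>?m \<omega> - f x\<bar> \<le> \<rho>} \<in> events"
        unfolding space_sample_law sets_sample_law by measurable
      have "\<bar>?m \<omega> - f x\<bar> \<le> \<rho>" if "case bisect pr K ?\<delta> \<kappa> \<omega> L (a, b) of (u, v) \<Rightarrow> f x \<in> {u..v}" for \<omega>
      proof -
        obtain u v where uv: "bisect pr K ?\<delta> \<kappa> \<omega> L (a, b) = (u, v)"
          by fastforce
        then have "u \<le> f x" "f x \<le> v" "?m \<omega> = (u + v) / 2"
          using that by (auto simp: midpoint_estimate_def)
        then show ?thesis
          using len[OF x uv] by (simp add: abs_le_iff field_simps)
      qed
      then show "{\<omega>\<in>space (sample_law Ob K (A x)).
          case bisect pr K ?\<delta> \<kappa> \<omega> L (a, b) of (u, v) \<Rightarrow> f x \<in> {u..v}}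
        \<subseteq> {\<omega> \<in> space (sample_law Ob K (A x)). \<bar>?m \<omega> - f x\<bar> \<le> \<rho>}"
        by (intro Collect_mono conj_mono impI)
    qed
    finally show ?thesis .
  qed
  then show ?thesis
    using m by (simp add: reliable_def)
qed

lemma midpoint_estimate_near_optimal:
  assumes range: "\<And>x. x \<in> signal_set pr \<Longrightarrow> a \<le> f x \<and> f x \<le> b"
    and \<epsilon>: "0 < \<epsilon>" "\<epsilon> < 1/2" and \<rho>': "0 < \<rho>'" "2 * \<rho>' < \<rho>" and k: "1 \<le> k"
    and rel: "reliable pr f k \<rho>' \<epsilon> fhat" and ab: "2 * \<rho> < b - a"
  defines "L \<equiv> nat \<lceil>log 2 ((b - a) / (2 * \<rho>))\<rceil>"
  defines "K \<equiv> nat \<lceil>2 * ln (2 * real L * real N * real I / \<epsilon>) / ln (1 / (4 * \<epsilon> * (1 - \<epsilon>))) * real k\<rceil>"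
  shows "reliable pr f K \<rho> \<epsilon> (midpoint_estimate pr K L (\<epsilon> / (2 * real L)) (\<rho> - 2 * \<rho>') a b)"
proof -
  have \<rho>: "0 < \<rho>" "a < b" using \<rho>' ab by auto
  define q where "q = (b - a) / (2 * \<rho>)"
  have q: "1 < q" using ab \<rho> by (simp add: q_def)
  \<comment> \<open>A positive logarithm gives \<open>L \<ge> 1\<close>, and rounding up makes
    \<open>2 ^ L\<close> halve the initial segment often enough.\<close>
  then have "0 < log 2 q" by simp
  then have L: "1 \<le> L" "log 2 q \<le> real L"
    unfolding L_def q_def[symmetric] by linarith+
  have "q \<le> 2 ^ L"
    using L(2) q by (simp add: log_le_iff powr_realpow)
  then have len0: "b - a \<le> 2 * \<rho> * 2 ^ L"
    using \<rho> by (simp add: q_def field_simps)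
  have K: "2 * ln (2 * real L * real N * real I / \<epsilon>) / ln (1 / (4 * \<epsilon> * (1 - \<epsilon>))) * real k \<le> real K"
    unfolding K_def by (rule real_nat_ceiling_ge)
  have long: "right_risk pr K a' b' \<le> \<epsilon> / (2 * real L)"
    if "2 * \<rho>' < b' - a'" "a' < b'" "lower_feasible pr a'" for a' b'
    using that by (intro right_risk_le_of_reliable[OF rel k \<epsilon> _ _ _ L(1) K])
  show ?thesis
  proof (rule midpoint_estimate_reliable[OF \<rho>(2) range \<epsilon>(1) _ L(1)])
    show "v - u \<le> 2 * \<rho>"
      if "bisect pr K (\<epsilon> / (2 * real L)) (\<rho> - 2 * \<rho>') \<omega> L (a, b) = (u, v)" for \<omega> u v
      using long \<epsilon> \<rho>' \<rho>(2) len0 that by (intro bisect_length) auto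
  qed (use \<rho>' in auto)
qed

end

theorem proposition4p2:
  fixes Ob :: "('w::polish_space, 'm::euclidean_space) obs_scheme"
    and XX :: "'n::euclidean_space set"
    and I :: nat and X :: "nat \<Rightarrow> 'n set"
    and A :: "'n \<Rightarrow> 'm" and f :: "'n \<Rightarrow> real"
    and N :: nat and Xge Xle :: "real \<Rightarrow> nat \<Rightarrow> 'n set"
    and rs :: "real \<Rightarrow> real \<Rightarrow> nat \<Rightarrow> nat \<Rightarrow> 'n \<times> 'n"
    and pr :: "('w, 'm, 'n) problem"
    and a0 b0 \<epsilon> :: real
  assumes "pr = \<lparr> scheme = Ob, encode = A, num = I, part = X, ncvx = N,
                 ge_rep = Xge, le_rep = Xle, sel = rs \<rparr>"
    and "good_obs_scheme Ob"
    and "convex XX" and "compact XX"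
    and "\<forall>i\<in>{1..I}. convex (X i) \<and> compact (X i) \<and> X i \<subseteq> XX"
    and "affine_map_on XX A" and "A ` XX \<subseteq> params Ob"
    and "continuous_on XX f"
    and "N_convex_rep XX f N Xge Xle"
    and "valid_selection pr"
    and "a0 < b0"
    and "\<forall>x\<in>signal_set pr. a0 \<le> f x" and "\<forall>x\<in>signal_set pr. f x \<le> b0"
    and "0 < \<epsilon>" and "\<epsilon> < 1/2"
  shows
    "(\<forall>(K::nat) (L::nat) (\<kappa>::real). L \<ge> 1 \<and> \<kappa> > 0 \<longrightarrow>
        (\<forall>x\<in>signal_set pr.
           measure (sample_law Ob K (A x))
             {\<omega> \<in> space (sample_law Ob K (A x)).
                case bisect pr K (\<epsilon> / (2 * real L)) \<kappa> \<omega> L (a0, b0) of (u, v) \<Rightarrow> f x \<in> {u..v}}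
           \<ge> 1 - \<epsilon>))
     \<and>
     (\<forall>(\<rho>bar::real) (Kbar::nat) (\<rho>::real).
        \<rho>bar > 0 \<and> Kbar \<ge> 1 \<and> (\<exists>fhat. reliable pr f Kbar \<rho>bar \<epsilon> fhat) \<and> \<rho> > 2 * \<rho>bar \<longrightarrow>
        (b0 - a0 > 2 * \<rho> \<longrightarrow>
          (let L = nat \<lceil>log 2 ((b0 - a0) / (2 * \<rho>))\<rceil>;
               K = nat \<lceil>2 * ln (2 * real L * real N * real I / \<epsilon>)
                          / ln (1 / (4 * \<epsilon> * (1 - \<epsilon>))) * real Kbar\<rceil>
           in reliable pr f K \<rho> \<epsilon>
                (midpoint_estimate pr K L (\<epsilon> / (2 * real L)) (\<rho> - 2 * \<rho>bar) a0 b0))) \<and>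
        (b0 - a0 \<le> 2 * \<rho> \<longrightarrow>
          (\<forall>K. reliable pr f K \<rho> \<epsilon> (\<lambda>_. (a0 + b0) / 2))))"
proof -
  interpret bisection Ob XX I X A f N Xge Xle rs pr
    by unfold_locales (use assms in auto)
  have range: "a0 \<le> f x \<and> f x \<le> b0" if "x \<in> signal_set pr" for x
    using assms that by blast
  show ?thesis
  proof (intro conjI allI impI ballI)
    fix K L :: nat and \<kappa> :: real and x
    assume "L \<ge> 1 \<and> \<kappa> > 0" "x \<in> signal_set pr"
    then show "1 - \<epsilon> \<le> measure (sample_law Ob K (A x))
      {\<omega> \<in> space (sample_law Ob K (A x)).
        case bisect pr K (\<epsilon> / (2 * real L)) \<kappa> \<omega> L (a0, b0) of (u, v) \<Rightarrow> f x \<in> {u..v}}"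
      using range \<open>a0 < b0\<close> \<open>0 < \<epsilon>\<close> by (intro bisect_reliable) auto
  next
    fix \<rho>bar :: real and Kbar :: nat and \<rho> :: real
    assume "\<rho>bar > 0 \<and> Kbar \<ge> 1 \<and> (\<exists>fhat. reliable pr f Kbar \<rho>bar \<epsilon> fhat) \<and> \<rho> > 2 * \<rho>bar"
      and "b0 - a0 > 2 * \<rho>"
    then show "let L = nat \<lceil>log 2 ((b0 - a0) / (2 * \<rho>))\<rceil>;
               K = nat \<lceil>2 * ln (2 * real L * real N * real I / \<epsilon>)
                          / ln (1 / (4 * \<epsilon> * (1 - \<epsilon>))) * real Kbar\<rceil>
           in reliable pr f K \<rho> \<epsilon>
                (midpoint_estimate pr K L (\<epsilon> / (2 * real L)) (\<rho> - 2 * \<rho>bar) a0 b0)"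
      unfolding Let_def
      using range \<open>0 < \<epsilon>\<close> \<open>\<epsilon> < 1/2\<close> midpoint_estimate_near_optimal by blast
  next
    fix \<rho>bar :: real and Kbar :: nat and \<rho> :: real and K :: nat
    assume "b0 - a0 \<le> 2 * \<rho>"
    then show "reliable pr f K \<rho> \<epsilon> (\<lambda>_. (a0 + b0) / 2)"
      using range \<open>0 < \<epsilon>\<close> by (intro reliable_const) (force simp: abs_le_iff field_simps)+
  qed
qed

end
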